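(* Fix $a\in(1/2,1)$, let $h(x)=\max\{1-|x-1|,0\}$, $g=(0,h)^T$, and for $t=(t_k)_{k\ge1}\in[0,1]^{\mathbb N}$ let $$A_0^{[k]}=\begin{pmatrix}a&0\\0&1/2\end{pmatrix},\quad A_1^{[k]}=\begin{pmatrix}0&0\\0&1\end{pmatrix},\quad A_2^{[k]}=\begin{pmatrix}0&t_k\\0&1/2\end{pmatrix},\qquad (V_kf)(x)=\sum_{j=0}^2A_j^{[k]}f(2x-j).$$ Then: (i) For every $t\in[0,1]^{\mathbb N}$ and every $n\ge1$, with $$\Phi_t=(\phi_t,h)^T,\qquad \phi_t(x)=\sum_{k\ge1}a^{k-1}t_k\,h(2^kx-2),$$ one has $\|V_1\cdots V_ng-\Phi_t\|_\infty\le a^n$; moreover, for the constant matching map $P_k=P=(0,1,0,1)$, the defects satisfy $\delta_k=0$ for all $k$ and the chronological radius is $\rho_{\rm ch}=a$. (ii) Let $\mathcal C_a=\{\phi_t:t\in[0,1]^{\mathbb N}\}$. For all $t,s\in[0,1]^{\mathbb N}$, $$\|\phi_t-\phi_s\|_\infty=\sup_{k\ge1}a^{k-1}|t_k-s_k|,$$ and $$H_\varepsilon(\mathcal C_a)=\frac{(\log_2\varepsilon^{-1})^2}{2\log_2a^{-1}}+O_a(\log\varepsilon^{-1}),\qquad \varepsilon\downarrow0.$$ The vector class $\{\Phi_t:t\in[0,1]^{\mathbb N}\}$ has the same entropy. (iii) If $a\in\mathbb Q$, then for small $\varepsilon>0$ there is a deterministic fixed-length code for $\mathcal C_a$ with worst-case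 distortion at most $\varepsilon$, whose reconstructions are functions $\phi_{\hat t}$ with $\hat t$ having finitely many nonzero coordinates, all dyadic rationals, with bit length $$B_\varepsilon\le\frac{(\log_2\varepsilon^{-1})^2}{2\log_2a^{-1}}+O_a(\log\varepsilon^{-1}),$$ and such that every reconstruction is computed exactly on $\mathbb R$ by a ReLU network with rational parameters, of width $O(1)$ and with depth and number of parameters $O_a(\log\varepsilon^{-1})$. The leading coefficient $1/(2\log_2a^{-1})$ of $(\log_2\varepsilon^{-1})^2$ is optimal among all deterministic fixed-length codes of worst-case distortion $\varepsilon$.
   Context: Conventions. $\|f\|_\infty=\sup_{x\in\mathbb R}\max_i|f_i(x)|$. In $V_1\cdots V_ng$ the rightmost operator acts first. A ReLU network consists of affine maps separated by coordinatewise activations $t\mapsto\max\{t,0\}$ with an affine output layer; width is the largest hidden dimension, depth the number of hidden layers, and the parameter count includes all affine entries. Matching and radius. Use the window $[\ell_-,\ell_+]=[0,2]$, so the block state is $G_f(x)=(f(x),f(x+1))^T\in\mathbb R^4$ for $x\in[0,1]$. For $\epsilon\in\{0,1\}$, $T^{[k]}_\epsilon\in\mathbb R^{4\times4}$ has $2\times2$ blocks $[T^{[k]}_\epsilon]_{i\ell}=A^{[k]}_{2i-\ell-1+\epsilon}$, $i,\ell\in\{1,2\}$ (with $A_j^{[k]}=0$ for $j\notin\{0,1,2\}$). For matching maps $P_k$ (full row rank), $U_k$ has columns forming an orthonormal basis of $\ker P_k$, $S_k=[\,U_k\ \ P_k^\dagger\,]$ with $P_k^\dagger$ the pseudoinverse,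 and $C_{k,\epsilon}=U_k^TT_\epsilon^{[k]}U_{k+1}$. The chronological radius is $\rho_{\rm ch}=\lim_{m\to\infty}\chi_m^{1/m}$ with $\chi_m=\sup_{b\ge1}\max_{\epsilon_b,\dots,\epsilon_{b+m-1}\in\{0,1\}}\|C_{b,\epsilon_b}\cdots C_{b+m-1,\epsilon_{b+m-1}}\|$. The defect is $\delta_k=\max_\epsilon\|(P_kT^{[k]}_\epsilon-P_{k+1})S_{k+1}\|_2+\sup_{x\in[0,1]}\|P_kG_{V_kg-g}(x)\|_2$. Entropy and codes. For a compact function class $\mathcal C$, $N(\varepsilon,\mathcal C)$ is the minimal number of closed uniform-norm balls of radius $\varepsilon$, with arbitrary bounded functions as centers, covering $\mathcal C$, and $H_\varepsilon(\mathcal C)=\log_2N(\varepsilon,\mathcal C)$. A deterministic fixed-length code of bit length $B$ is a pair of maps: an encoder $E:\mathcal C\to\{0,1\}^B$ and a decoder $R$ from $\{0,1\}^B$ to bounded functions; its worst-case distortion is $\sup_{f\in\mathcal C}\|f-R(E(f))\|_\infty$. The decoder, $a$ and $\varepsilon$ are shared and not counted in $B$. $O_a$ denotes constants depending only on $a$. *)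

theory Defs
  imports "HOL-Analysis.Analysis"
begin

subsection \<open>Uniform norm and subdivision operators\<close>

text \<open>The supremum is taken in the extended reals, so that a bound on it is meaningful
  for every function; \<^const>\<open>infnorm\<close> is the maximum of the absolute values of the coordinates
  (and the absolute value on the reals).\<close>

definition sup_norm :: "(real \<Rightarrow> 'a::euclidean_space) \<Rightarrow> ereal" where
  "sup_norm f = (SUP x. ereal (infnorm (f x)))"

definition hat :: "real \<Rightarrow> real" where
  "hat x = max (1 - \<bar>x - 1\<bar>) 0"

definition gen :: "real \<Rightarrow> real^2" where
  "gen x = vector [0, hat x]"

definition subdiv_mask :: "real \<Rightarrow> real \<Rightarrow> int \<Rightarrow> real^2^2" where
  "subdiv_mask a \<tau> j =
    (if j = 0 then vector [vector [a, 0], vector [0, 1/2]]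
     else if j = 1 then vector [vector [0, 0], vector [0, 1]]
     else if j = 2 then vector [vector [0, \<tau>], vector [0, 1/2]]
     else 0)"

definition subdiv :: "(int \<Rightarrow> real^2^2) \<Rightarrow> (real \<Rightarrow> real^2) \<Rightarrow> real \<Rightarrow> real^2" where
  "subdiv A f x = (\<Sum>j\<in>{0..2}. A j *v f (2 * x - of_int j))"

text \<open>\<open>cascade V n g\<close> is \<open>V\<^sub>1 (V\<^sub>2 (\<dots> (V\<^sub>n g)))\<close>.\<close>

definition cascade :: "(nat \<Rightarrow> 'f \<Rightarrow> 'f) \<Rightarrow> nat \<Rightarrow> 'f \<Rightarrow> 'f" where
  "cascade V n g = foldr V [1..<Suc n] g"

text \<open>Sequences are indexed by \<open>k \<ge> 1\<close>; the value at \<open>0\<close> is never used.\<close>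

definition unit_seqs :: "(nat \<Rightarrow> real) set" where
  "unit_seqs = {t. \<forall>k\<ge>1. t k \<in> {0..1}}"

text \<open>The summation index is \<open>k - 1\<close>.\<close>

definition phi :: "real \<Rightarrow> (nat \<Rightarrow> real) \<Rightarrow> real \<Rightarrow> real" where
  "phi a t x = (\<Sum>k. a ^ k * t (Suc k) * hat (2 ^ Suc k * x - 2))"

definition Phi :: "real \<Rightarrow> (nat \<Rightarrow> real) \<Rightarrow> real \<Rightarrow> real^2" where
  "Phi a t x = vector [phi a t x, hat x]"


subsection \<open>Matching, defect and chronological radius\<close>

definition block_state :: "(real \<Rightarrow> real^2) \<Rightarrow> real \<Rightarrow> real^4" where
  "block_state f x = vector [f x $ 1, f x $ 2, f (x + 1) $ 1, f (x + 1) $ 2]"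

text \<open>Coordinate \<open>r\<close> of a vector in \<open>\<real>\<^sup>4\<close> is coordinate \<open>inner_idx r\<close> of the \<open>block_idx r\<close>-th block
  of length 2.\<close>

definition block_idx :: "4 \<Rightarrow> int" where
  "block_idx r = (if r = 1 \<or> r = 2 then 1 else 2)"

definition inner_idx :: "4 \<Rightarrow> 2" where
  "inner_idx r = (if r = 1 \<or> r = 3 then 1 else 2)"

definition block_matrix :: "(int \<Rightarrow> real^2^2) \<Rightarrow> int \<Rightarrow> real^4^4" where
  "block_matrix A \<epsilon> =
    (\<chi> r c. A (2 * block_idx r - block_idx c - 1 + \<epsilon>) $ inner_idx r $ inner_idx c)"

definition op_norm :: "real^'n^'m \<Rightarrow> real" where
  "op_norm M = onorm ((*v) M)"

text \<open>Moore--Penrose pseudoinverse, by the four Penrose equations.\<close>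

definition pinv :: "real^'n^'m \<Rightarrow> real^'m^'n" where
  "pinv M = (THE X. M ** X ** M = M \<and> X ** M ** X = X \<and>
                    transpose (M ** X) = M ** X \<and> transpose (X ** M) = X ** M)"

definition orthonormal_kernel_basis :: "real^'n^'r \<Rightarrow> real^'d^'n \<Rightarrow> bool" where
  "orthonormal_kernel_basis P U \<longleftrightarrow>
     transpose U ** U = mat 1 \<and> span (columns U) = {v. P *v v = 0}"

definition hcat :: "real^'d^'n \<Rightarrow> real^'r^'n \<Rightarrow> real^('d + 'r)^'n" where
  "hcat U Q = (\<chi> i j. case j of Inl c \<Rightarrow> U $ i $ c | Inr c \<Rightarrow> Q $ i $ c)"

definition defect ::
  "(nat \<Rightarrow> real^4^'r) \<Rightarrow> (nat \<Rightarrow> real^'d^4) \<Rightarrow> (nat \<Rightarrow> int \<Rightarrow> real^2^2) \<Rightarrow>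
   (real \<Rightarrow> real^2) \<Rightarrow> nat \<Rightarrow> ereal" where
  "defect P U A g k =
     ereal (MAX \<epsilon>\<in>{0, 1}. op_norm ((P k ** block_matrix (A k) \<epsilon> - P (Suc k)) **
                                    hcat (U (Suc k)) (pinv (P (Suc k))))) +
     (SUP x\<in>{0..1}. ereal (norm (P k *v block_state (\<lambda>y. subdiv (A k) g y - g y) x)))"

definition kernel_block ::
  "(nat \<Rightarrow> real^'d^4) \<Rightarrow> (nat \<Rightarrow> int \<Rightarrow> real^2^2) \<Rightarrow> nat \<Rightarrow> int \<Rightarrow> real^'d^'d" where
  "kernel_block U A k \<epsilon> = transpose (U k) ** block_matrix (A k) \<epsilon> ** U (Suc k)"

primrec chron_prod :: "(nat \<Rightarrow> int \<Rightarrow> real^'d^'d) \<Rightarrow> nat \<Rightarrow> int list \<Rightarrow> real^'d^'d" where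
  "chron_prod C b [] = mat 1"
| "chron_prod C b (\<epsilon> # w) = C b \<epsilon> ** chron_prod C (Suc b) w"

definition chron_max :: "(nat \<Rightarrow> int \<Rightarrow> real^'d^'d) \<Rightarrow> nat \<Rightarrow> nat \<Rightarrow> real" where
  "chron_max C m b = (MAX w\<in>{w. set w \<subseteq> {0, 1} \<and> length w = m}. op_norm (chron_prod C b w))"

text \<open>The first conjunct says that the suprema \<open>\<chi>\<^sub>m\<close>, taken in the reals, are finite.\<close>

definition has_chron_radius :: "(nat \<Rightarrow> int \<Rightarrow> real^'d^'d) \<Rightarrow> real \<Rightarrow> bool" where
  "has_chron_radius C \<rho> \<longleftrightarrow>
     (\<forall>m. bdd_above (chron_max C m ` {1..})) \<and>
     (\<lambda>m. root m (SUP b\<in>{1..}. chron_max C m b)) \<longlonglongrightarrow> \<rho>"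

definition match_map :: "real^4^1" where
  "match_map = rowvector (vector [0, 1, 0, 1])"

lemma vector_4 [simp]:
  "(vector [x, y, z, w] :: 'a::zero^4) $ 1 = x"
  "(vector [x, y, z, w] :: 'a::zero^4) $ 2 = y"
  "(vector [x, y, z, w] :: 'a::zero^4) $ 3 = z"
  "(vector [x, y, z, w] :: 'a::zero^4) $ 4 = w"
  unfolding vector_def by auto

lemma rank_match_map: "rank match_map = CARD(1)"
proof -
  have "rows match_map = {vector [0, 1, 0, 1]}"
    by (auto simp: rows_def row_def match_map_def rowvector_def vec_eq_iff)
  moreover have "(vector [0, 1, 0, 1] :: real^4) \<noteq> 0"
    by (auto simp: vec_eq_iff forall_4)
  ultimately show ?thesis
    by (simp add: row_rank_def dim_singleton)
qed

lemma orthonormal_kernel_basis_match_map: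
  "\<exists>U :: real^3^4. orthonormal_kernel_basis match_map U"
proof -
  define s :: real where "s = 1 / sqrt 2"
  have s: "s * s = 1/2" "s \<noteq> 0" by (auto simp: s_def)
  define U :: "real^3^4" where
    "U = vector [vector [1, 0, 0], vector [0, 0, s], vector [0, 1, 0], vector [0, 0, - s]]"
  have "transpose U ** U = mat 1"
    by (auto simp: vec_eq_iff forall_3 matrix_matrix_mult_def transpose_def sum_4 U_def mat_def s)
  moreover have "span (columns U) = {v. match_map *v v = 0}"
  proof
    have "columns U \<subseteq> {v. match_map *v v = 0}"
      by (auto simp: columns_def column_def match_map_def rowvector_def matrix_vector_mult_def
          vec_eq_iff sum_4 U_def) (metis (no_types) exhaust_3 vector_3 add.right_inverse add_0)
    then show "span (columns U) \<subseteq> {v. match_map *v v = 0}"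
      by (intro span_minimal) (auto simp: subspace_def matrix_vector_right_distrib
          matrix_vector_mult_scaleR)
  next
    have "v = U *v vector [v $ 1, v $ 3, v $ 2 / s]" if "match_map *v v = 0" for v
      using that s by (auto simp: match_map_def rowvector_def matrix_vector_mult_def
          vec_eq_iff sum_4 sum_3 forall_4 U_def)
    then show "{v. match_map *v v = 0} \<subseteq> span (columns U)"
      using matrix_vector_mult_in_columnspace by (metis (mono_tags, lifting) mem_Collect_eq subsetI)
  qed
  ultimately show ?thesis unfolding orthonormal_kernel_basis_def by blast
qed


subsection \<open>Entropy and codes\<close>

text \<open>The infimum is \<open>\<infinity>\<close> if there is no finite cover.\<close>

definition covering_number :: "real \<Rightarrow> (real \<Rightarrow> 'a::euclidean_space) set \<Rightarrow> enat" where
  "covering_number \<epsilon> F =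
     (INF S \<in> {S. finite S \<and> (\<forall>c\<in>S. bounded (range c)) \<and>
                   F \<subseteq> (\<Union>c\<in>S. {f. sup_norm (\<lambda>x. f x - c x) \<le> ereal \<epsilon>})}. enat (card S))"

definition entropy :: "real \<Rightarrow> (real \<Rightarrow> 'a::euclidean_space) set \<Rightarrow> ereal" where
  "entropy \<epsilon> F = (case covering_number \<epsilon> F of enat n \<Rightarrow> ereal (log 2 (real n)) | \<infinity> \<Rightarrow> \<infinity>)"

definition fixed_length_code ::
  "(real \<Rightarrow> real) set \<Rightarrow> nat \<Rightarrow> ((real \<Rightarrow> real) \<Rightarrow> bool list) \<Rightarrow> (bool list \<Rightarrow> real \<Rightarrow> real) \<Rightarrow> bool" where
  "fixed_length_code F B E R \<longleftrightarrow>
     (\<forall>f\<in>F. length (E f) = B) \<and> (\<forall>w. length w = B \<longrightarrow> bounded (range (R w)))"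

definition distortion ::
  "(real \<Rightarrow> real) set \<Rightarrow> ((real \<Rightarrow> real) \<Rightarrow> bool list) \<Rightarrow> (bool list \<Rightarrow> real \<Rightarrow> real) \<Rightarrow> ereal" where
  "distortion F E R = (SUP f\<in>F. sup_norm (\<lambda>x. f x - R (E f) x))"


subsection \<open>ReLU networks\<close>

text \<open>An affine map is given by the list of rows of its matrix and its bias vector; a network
  is given by the list of its hidden layers, first layer first, and its output layer.\<close>

type_synonym affine = "real list list \<times> real list"

type_synonym network = "affine list \<times> affine"

definition out_dim :: "affine \<Rightarrow> nat" where
  "out_dim L = length (snd L)"

definition affine_ok :: "nat \<Rightarrow> affine \<Rightarrow> bool" where
  "affine_ok d L \<longleftrightarrow> length (fst L) = length (snd L) \<and> (\<forall>r\<in>set (fst L). length r = d)"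

definition affine_apply :: "affine \<Rightarrow> real list \<Rightarrow> real list" where
  "affine_apply L v = map2 (\<lambda>r \<beta>. (\<Sum>(p, q)\<leftarrow>zip r v. p * q) + \<beta>) (fst L) (snd L)"

definition affine_entries :: "affine \<Rightarrow> real list" where
  "affine_entries L = concat (fst L) @ snd L"

fun hidden_ok :: "nat \<Rightarrow> affine list \<Rightarrow> affine \<Rightarrow> nat \<Rightarrow> bool" where
  "hidden_ok d [] L e \<longleftrightarrow> affine_ok d L \<and> out_dim L = e"
| "hidden_ok d (H # Hs) L e \<longleftrightarrow> affine_ok d H \<and> hidden_ok (out_dim H) Hs L e"

definition network_ok :: "nat \<Rightarrow> nat \<Rightarrow> network \<Rightarrow> bool" where
  "network_ok d e N \<longleftrightarrow> hidden_ok d (fst N) (snd N) e"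

definition network_eval :: "network \<Rightarrow> real list \<Rightarrow> real list" where
  "network_eval N v =
     affine_apply (snd N) (fold (\<lambda>H u. map (\<lambda>y. max y 0) (affine_apply H u)) (fst N) v)"

definition network_width :: "network \<Rightarrow> nat" where
  "network_width N = Max (insert 0 (out_dim ` set (fst N)))"

definition network_depth :: "network \<Rightarrow> nat" where
  "network_depth N = length (fst N)"

definition network_params :: "network \<Rightarrow> real list" where
  "network_params N = concat (map affine_entries (fst N @ [snd N]))"

definition computes :: "network \<Rightarrow> (real \<Rightarrow> real) \<Rightarrow> bool" where
  "computes N f \<longleftrightarrow> network_ok 1 1 N \<and> (\<forall>x. network_eval N [x] = [f x])"

end

theory Submission
  imports Defs
begin

text \<open>The functions \<open>x \<mapsto> hat (2 ^ k * x - 2)\<close> have pairwise disjoint supports, so every point sees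
  at most one term of the series \<open>phi\<close>, and the class of all \<open>phi a t\<close> is isometric to the box
  with side lengths \<open>a ^ (k - 1)\<close> in the maximum norm. Packing and quantising this box coordinate by
  coordinate gives \<open>\<Sum>k (log (1/\<epsilon>) - k * log (1/a)) + O(log (1/\<epsilon>))\<close> bits, the sum running over the
  coordinates with positive summand; this arithmetic progression is the stated quadratic. The matching
  map is a common left eigenvector of all block matrices, so products of the kernel blocks are
  restrictions of products of block matrices to the kernel, where a suitable maximum norm contracts
  by the factor \<open>a\<close> in each step, and this factor is attained on the first coordinate vector.\<close>

section \<open>The hat function and the disjoint supports of its dilates\<close>

lemma hat_nonneg: "0 \<le> hat x"
  and hat_le_1: "hat x \<le> 1"
  and hat_eq_0: "x \<le> 0 \<or> 2 \<le> x \<Longrightarrow> hat x = 0"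
  by (auto simp: hat_def)

text \<open>Writes the bump as a second difference of ramps, the form in which a ReLU layer can
  evaluate it.\<close>

lemma hat_relu:
  "hat (x - 2) = max (x - 2) 0 - 2 * max (x - 3) 0 + max (x - 4) 0"
  by (auto simp: hat_def max_def abs_if)

text \<open>The two-scale relation of the linear B-spline. It keeps the second component of the
  cascade equal to \<open>hat\<close> and makes the defect of \<open>gen\<close> invisible to the
  matching map.\<close>

lemma hat_refine: "hat x = hat (2 * x) / 2 + hat (2 * x - 1) + hat (2 * x - 2) / 2"
  by (auto simp: hat_def max_def abs_if field_simps)

text \<open>Bump number \<open>j\<close> lives on the dyadic shell \<open>1 < 2 ^ j * x < 2\<close>,
  and different shells are disjoint. If no bump is active at \<open>x\<close>, any \<open>k\<close>
  serves, so pointwise arguments need no case distinction.\<close>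

lemma hat_supports_disjoint:
  obtains k :: nat where "\<forall>j. j \<noteq> k \<longrightarrow> hat (2 ^ Suc j * x - 2) = 0"
proof -
  have range: "1 < 2 ^ j * x \<and> 2 ^ j * x < 2" if "hat (2 ^ Suc j * x - 2) \<noteq> 0" for j
  proof (rule ccontr)
    assume "\<not> ?thesis"
    then have "2 ^ Suc j * x - 2 \<le> 0 \<or> 2 \<le> 2 ^ Suc j * x - 2"
      by (auto simp: mult_ac)
    then show False
      using that hat_eq_0 by blast
  qed
  have less: False
    if "i < j" "hat (2 ^ Suc i * x - 2) \<noteq> 0" "hat (2 ^ Suc j * x - 2) \<noteq> 0" for i j :: nat
  proof -
    have i: "1 < 2 ^ i * x" and j: "2 ^ j * x < 2"
      using range that by auto
    have "0 < x"
      using i by (smt (verit) zero_less_mult_iff zero_less_power)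
    moreover have "(2::real) ^ Suc i \<le> 2 ^ j"
      using \<open>i < j\<close> by (intro power_increasing) auto
    ultimately have "2 ^ Suc i * x \<le> 2 ^ j * x"
      by (intro mult_right_mono) auto
    then show False
      using i j by auto
  qed
  show thesis
  proof (cases "\<exists>k. hat (2 ^ Suc k * x - 2) \<noteq> 0")
    case True
    then obtain k where "hat (2 ^ Suc k * x - 2) \<noteq> 0" by blast
    then show thesis
      using that[of k] less by (metis linorder_neqE_nat)
  qed (use that in blast)
qed

lemma phi_single:
  assumes "\<forall>j. j \<noteq> k \<longrightarrow> hat (2 ^ Suc j * x - 2) = 0"
  shows "phi a t x = a ^ k * t (Suc k) * hat (2 ^ Suc k * x - 2)"
  unfolding phi_def using assms by (subst suminf_finite[of "{k}"]) auto

lemma phi_partial_sum: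
  assumes "\<And>k. k \<ge> n \<Longrightarrow> t (Suc k) = 0"
  shows "phi a t x = (\<Sum>k<n. a ^ k * t (Suc k) * hat (2 ^ Suc k * x - 2))"
  unfolding phi_def using assms by (intro suminf_finite) auto

text \<open>The sample point is the peak of bump number \<open>k\<close>. Point evaluation thus
  recovers every scaled coordinate exactly, which gives the lower half of the isometry.\<close>

lemma phi_sample: "phi a t (3 / 2 ^ Suc k) = a ^ k * t (Suc k)"
proof -
  have one: "hat (2 ^ Suc k * (3 / 2 ^ Suc k) - 2) = 1"
    by (simp add: hat_def)
  obtain j where j: "\<forall>i. i \<noteq> j \<longrightarrow> hat (2 ^ Suc i * (3 / 2 ^ Suc k) - 2) = 0"
    using hat_supports_disjoint by metis
  have "k = j"
    using j one by force
  then show ?thesis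
    using phi_single[OF j, where a = a and t = t] one by simp
qed

lemma infnorm_real: "infnorm (x::real) = \<bar>x\<bar>"
  by (simp add: infnorm_def)

lemma sup_norm_le_iff: "sup_norm f \<le> ereal c \<longleftrightarrow> (\<forall>x. infnorm (f x) \<le> c)"
  by (simp add: sup_norm_def SUP_le_iff)

lemma unit_seqs_bounds: "t \<in> unit_seqs \<Longrightarrow> 0 \<le> t (Suc k) \<and> t (Suc k) \<le> 1"
  by (auto simp: unit_seqs_def)

lemma abs_phi_le_1:
  assumes "0 \<le> a" "a \<le> 1" "t \<in> unit_seqs"
  shows "\<bar>phi a t x\<bar> \<le> 1"
proof -
  obtain k where k: "\<forall>j. j \<noteq> k \<longrightarrow> hat (2 ^ Suc j * x - 2) = 0"
    using hat_supports_disjoint by metis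
  show ?thesis
    using assms unit_seqs_bounds[OF assms(3), of k]
    by (auto simp: phi_single[OF k] hat_nonneg hat_le_1 abs_mult power_le_one intro!: mult_le_one)
qed

text \<open>Reconstructions must be bounded to be admissible decoder values.\<close>

lemma bounded_range_phi:
  assumes "0 \<le> a" "a \<le> 1" "t \<in> unit_seqs"
  shows "bounded (range (phi a t))"
  using abs_phi_le_1[OF assms] by (auto simp: bounded_iff)

subsection \<open>Limit of the cascade and uniform distances\<close>

lemma subdiv_mask_apply:
  "subdiv (subdiv_mask a \<tau>) f x =
    vector [a * f (2 * x) $ 1 + \<tau> * f (2 * x - 2) $ 2,
            f (2 * x) $ 2 / 2 + f (2 * x - 1) $ 2 + f (2 * x - 2) $ 2 / 2]"
proof -
  have "{0..2::int} = {0, 1, 2}" by auto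
  then show ?thesis
    by (auto simp: subdiv_def subdiv_mask_def vec_eq_iff forall_2 matrix_vector_mult_def sum_2)
qed

text \<open>The outermost operator carries the smallest index, so the induction peels it off and
  needs an arbitrary starting index \<open>b\<close>; it evaluates at \<open>2 * x\<close>, so
  \<open>x\<close> varies too. Doubling the argument and multiplying by \<open>a\<close> turns term
  \<open>k\<close> into term \<open>k + 1\<close>.\<close>

lemma foldr_subdiv:
  "foldr (\<lambda>k. subdiv (subdiv_mask a (t k))) [b..<b + n] gen x =
    vector [\<Sum>k<n. a ^ k * t (b + k) * hat (2 ^ Suc k * x - 2), hat x]"
proof (induction n arbitrary: b x)
  case 0
  then show ?case by (simp add: gen_def)
next
  case (Suc n)
  have "foldr (\<lambda>k. subdiv (subdiv_mask a (t k))) [b..<b + Suc n] gen =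
    subdiv (subdiv_mask a (t b)) (foldr (\<lambda>k. subdiv (subdiv_mask a (t k))) [Suc b..<Suc b + n] gen)"
    by (subst upt_conv_Cons) (auto simp del: upt_Suc)
  then have "foldr (\<lambda>k. subdiv (subdiv_mask a (t k))) [b..<b + Suc n] gen x =
    subdiv (subdiv_mask a (t b)) (foldr (\<lambda>k. subdiv (subdiv_mask a (t k))) [Suc b..<Suc b + n] gen) x"
    by (rule fun_cong)
  then show ?case
    \<comment> \<open>The summand split off at \<open>k = 0\<close> is the entry
      \<open>t b * hat (2 * x - 2)\<close> of the third mask matrix.\<close>
    unfolding subdiv_mask_apply[of a "t b"] Suc.IH sum.lessThan_Suc_shift
    by (simp add: hat_refine[of x] sum_distrib_left mult_ac add.commute del: upt_Suc)
qed

text \<open>The error is the tail of the series from index \<open>n\<close> on. At each point at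
  most one tail term survives, so no geometric series factor appears.\<close>

lemma cascade_close:
  assumes "0 < a" "a < 1" "t \<in> unit_seqs"
  shows "sup_norm (\<lambda>x. cascade (\<lambda>k. subdiv (subdiv_mask a (t k))) n gen x - Phi a t x)
    \<le> ereal (a ^ n)"
  unfolding sup_norm_le_iff
proof
  fix x
  define d where "d = (\<Sum>k<n. a ^ k * t (Suc k) * hat (2 ^ Suc k * x - 2)) - phi a t x"
  have "cascade (\<lambda>k. subdiv (subdiv_mask a (t k))) n gen x =
    vector [\<Sum>k<n. a ^ k * t (Suc k) * hat (2 ^ Suc k * x - 2), hat x]"
    unfolding cascade_def using foldr_subdiv[where b = 1 and n = n] by simp
  then have "infnorm (cascade (\<lambda>k. subdiv (subdiv_mask a (t k))) n gen x - Phi a t x) = \<bar>d\<bar>"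
    by (simp add: infnorm_2 Phi_def d_def)
  also have "\<dots> \<le> a ^ n"
  proof -
    obtain k where k: "\<forall>j. j \<noteq> k \<longrightarrow> hat (2 ^ Suc j * x - 2) = 0"
      using hat_supports_disjoint by metis
    have sum: "(\<Sum>j<n. a ^ j * t (Suc j) * hat (2 ^ Suc j * x - 2)) =
      (if k < n then a ^ k * t (Suc k) * hat (2 ^ Suc k * x - 2) else 0)"
    proof -
      have "(\<Sum>j<n. a ^ j * t (Suc j) * hat (2 ^ Suc j * x - 2)) =
        (\<Sum>j<n. if j = k then a ^ k * t (Suc k) * hat (2 ^ Suc k * x - 2) else 0)"
        using k by (intro sum.cong) auto
      then show ?thesis by simp
    qed
    show ?thesis
    proof (cases "k < n")
      case True
      then show ?thesis
        using assms by (simp add: d_def sum phi_single[OF k] del: power_Suc)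
    next
      case False
      have "\<bar>d\<bar> = a ^ k * (t (Suc k) * hat (2 ^ Suc k * x - 2))"
        using False assms unit_seqs_bounds[OF assms(3), of k] hat_nonneg
        by (simp add: d_def sum phi_single[OF k] abs_mult del: power_Suc)
      also have "\<dots> \<le> a ^ k * 1"
        using assms unit_seqs_bounds[OF assms(3), of k] hat_nonneg hat_le_1
        by (intro mult_left_mono mult_le_one) auto
      also have "\<dots> \<le> a ^ n"
        using False assms by (auto intro: power_decreasing)
      finally show ?thesis .
    qed
  qed
  finally show "infnorm (cascade (\<lambda>k. subdiv (subdiv_mask a (t k))) n gen x - Phi a t x) \<le> a ^ n" .
qed

text \<open>The active index at \<open>x\<close> does not depend on the sequence, so both series
  reduce to the same bump, of height at most 1; the peaks attain each coordinate difference.\<close>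

lemma sup_norm_phi_diff:
  assumes "0 < a" "a < 1" "t \<in> unit_seqs" "s \<in> unit_seqs"
  shows "sup_norm (\<lambda>x. phi a t x - phi a s x) = (SUP k\<in>{1..}. ereal (a ^ (k - 1) * \<bar>t k - s k\<bar>))"
proof (rule antisym)
  show "sup_norm (\<lambda>x. phi a t x - phi a s x) \<le> (SUP k\<in>{1..}. ereal (a ^ (k - 1) * \<bar>t k - s k\<bar>))"
    unfolding sup_norm_def
  proof (rule SUP_least)
    fix x
    obtain k where k: "\<forall>j. j \<noteq> k \<longrightarrow> hat (2 ^ Suc j * x - 2) = 0"
      using hat_supports_disjoint by metis
    have "infnorm (phi a t x - phi a s x) = a ^ k * \<bar>t (Suc k) - s (Suc k)\<bar> * hat (2 ^ Suc k * x - 2)"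
      using assms hat_nonneg[of "2 ^ Suc k * x - 2"]
      unfolding phi_single[OF k] infnorm_real
      by (simp add: abs_mult flip: left_diff_distrib right_diff_distrib)
    also have "\<dots> \<le> a ^ k * \<bar>t (Suc k) - s (Suc k)\<bar>"
      using assms hat_nonneg hat_le_1 by (intro mult_left_le) auto
    finally show "ereal (infnorm (phi a t x - phi a s x)) \<le>
        (SUP k\<in>{1..}. ereal (a ^ (k - 1) * \<bar>t k - s k\<bar>))"
      by (intro SUP_upper2[of "Suc k"]) auto
  qed
  show "(SUP k\<in>{1..}. ereal (a ^ (k - 1) * \<bar>t k - s k\<bar>)) \<le> sup_norm (\<lambda>x. phi a t x - phi a s x)"
  proof (rule SUP_least)
    fix k :: nat
    assume "k \<in> {1..}"
    then obtain j where j: "k = Suc j" by (cases k) auto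
    have "phi a t (3 / 2 ^ Suc j) - phi a s (3 / 2 ^ Suc j) = a ^ j * (t k - s k)"
      by (simp only: phi_sample j right_diff_distrib)
    then have "infnorm (phi a t (3 / 2 ^ Suc j) - phi a s (3 / 2 ^ Suc j)) = a ^ (k - 1) * \<bar>t k - s k\<bar>"
      using assms by (simp add: infnorm_real abs_mult j del: power_Suc)
    then show "ereal (a ^ (k - 1) * \<bar>t k - s k\<bar>) \<le> sup_norm (\<lambda>x. phi a t x - phi a s x)"
      unfolding sup_norm_def by (intro SUP_upper2[of "3 / 2 ^ Suc j"]) auto
  qed
qed

subsection \<open>Matching and chronological radius\<close>

lemma match_map_apply: "match_map *v v = vec (v $ 2 + v $ 4)"
  by (auto simp: match_map_def rowvector_def matrix_vector_mult_def vec_eq_iff sum_4)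

lemma match_map_ker: "match_map *v v = 0 \<longleftrightarrow> v $ 4 = - v $ 2"
  by (auto simp: match_map_apply vec_eq_iff)

lemma block_matrix_apply:
  "block_matrix (subdiv_mask a \<tau>) 0 *v v =
    vector [a * v $ 1, v $ 2 / 2, \<tau> * v $ 2, v $ 2 / 2 + v $ 4]"
  "block_matrix (subdiv_mask a \<tau>) 1 *v v =
    vector [a * v $ 3, v $ 2 + v $ 4 / 2, \<tau> * v $ 4, v $ 4 / 2]"
  by (auto simp: vec_eq_iff forall_4 matrix_vector_mult_def sum_4 block_matrix_def
      subdiv_mask_def block_idx_def inner_idx_def)

text \<open>This is the sum rule of the mask \<open>1/2, 1, 1/2\<close> of \<open>hat\<close>: its
  even and its odd coefficients both sum to 1, so the sum of the second and fourth coordinates is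
  preserved.\<close>

lemma match_map_block_matrix:
  assumes "\<epsilon> \<in> {0, 1}"
  shows "match_map ** block_matrix (subdiv_mask a \<tau>) \<epsilon> = match_map"
proof -
  have "match_map *v (block_matrix (subdiv_mask a \<tau>) \<epsilon> *v v) = match_map *v v" for v
    unfolding match_map_apply using assms by (auto simp: block_matrix_apply)
  then show ?thesis
    by (simp add: matrix_eq flip: matrix_vector_mul_assoc)
qed

text \<open>The matrix part vanishes by the left eigenvector property. One subdivision step changes
  \<open>gen\<close> only in its first component, which \<open>match_map\<close> does not
  see.\<close>

lemma defect_eq_0:
  fixes U :: "nat \<Rightarrow> real^'d^4"
  shows "defect (\<lambda>_. match_map) U (\<lambda>k. subdiv_mask a (t k)) gen k = 0"
proof -
  have "match_map *v block_state (\<lambda>y. subdiv (subdiv_mask a (t k)) gen y - gen y) x = 0" for x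
    unfolding match_map_ker
    by (simp add: block_state_def subdiv_mask_apply gen_def hat_refine[of x] hat_refine[of "x + 1"])
  moreover have "op_norm (0 :: real^('d + 1)^1) = 0"
    by (simp add: op_norm_def onorm_eq_0)
  ultimately show ?thesis
    by (simp add: defect_def match_map_block_matrix flip: zero_ereal_def)
qed

section \<open>Passing from block matrices to kernel blocks\<close>

lemma span_columns_subset_range: "span (columns U) \<subseteq> range ((*v) (U :: real^'d^'n))"
proof (rule span_minimal)
  show "columns U \<subseteq> range ((*v) U)"
    by (auto simp: columns_def simp flip: matrix_vector_mult_basis)
  show "subspace (range ((*v) U))"
    by (intro linear_subspace_image matrix_vector_mul_linear subspace_UNIV)
qed

lemma orthonormal_kernel_basis_isometry:
  fixes U :: "real^'d^'n"
  assumes "orthonormal_kernel_basis P U"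
  shows "norm (U *v y) = norm y"
proof -
  have "(U *v y) \<bullet> (U *v y) = (transpose U ** U *v y) \<bullet> y"
    by (simp add: dot_lmul_matrix transpose_matrix_vector flip: matrix_vector_mul_assoc)
  also have "transpose U ** U = mat 1"
    using assms by (simp add: orthonormal_kernel_basis_def)
  finally show ?thesis
    by (simp add: norm_eq_sqrt_inner)
qed

text \<open>A kernel vector has the form \<open>U *v y\<close>, and \<open>transpose U\<close>
  recovers \<open>y\<close>. Hence \<open>U ** transpose U\<close> may be dropped wherever it meets
  a kernel vector.\<close>

lemma orthonormal_kernel_basis_proj:
  fixes U :: "real^'d^'n"
  assumes "orthonormal_kernel_basis P U" "P *v v = 0"
  shows "U *v (transpose U *v v) = v"
proof -
  have "v \<in> span (columns U)"
    using assms by (simp add: orthonormal_kernel_basis_def)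
  then obtain y where y: "v = U *v y"
    using span_columns_subset_range[of U] by auto
  have "transpose U *v v = y"
    using assms by (simp add: y orthonormal_kernel_basis_def matrix_vector_mul_assoc)
  then show ?thesis
    using y by simp
qed

lemma orthonormal_kernel_basis_in_ker:
  fixes U :: "real^'d^'n"
  assumes "orthonormal_kernel_basis P U"
  shows "P *v (U *v y) = 0"
  using assms matrix_vector_mult_in_columnspace[of U y] by (auto simp: orthonormal_kernel_basis_def)

text \<open>Every block matrix preserves the kernel of \<open>match_map\<close>, so the projections
  between consecutive factors act as the identity. The innermost factor ends in the basis with index
  \<open>b + length w\<close>.\<close>

lemma chron_prod_kernel_block:
  fixes U :: "nat \<Rightarrow> real^'d^4"
  assumes U: "\<And>k. k \<ge> 1 \<Longrightarrow> orthonormal_kernel_basis match_map (U k)"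
    and "b \<ge> 1" "set w \<subseteq> {0, 1}"
  shows "U b *v (chron_prod (kernel_block U (\<lambda>k. subdiv_mask a (t k))) b w *v y) =
    chron_prod (\<lambda>k. block_matrix (subdiv_mask a (t k))) b w *v (U (b + length w) *v y)"
  using assms(2,3)
proof (induction w arbitrary: b)
  case (Cons \<epsilon> w)
  let ?T = "block_matrix (subdiv_mask a (t b)) \<epsilon>"
  let ?z = "chron_prod (kernel_block U (\<lambda>k. subdiv_mask a (t k))) (Suc b) w *v y"
  have "match_map *v (?T *v (U (Suc b) *v ?z)) = match_map *v (U (Suc b) *v ?z)"
    using match_map_block_matrix[of \<epsilon> a "t b"] Cons.prems
    by (simp add: matrix_vector_mul_assoc matrix_mul_assoc)
  also have "\<dots> = 0"
    using orthonormal_kernel_basis_in_ker U Cons.prems by (metis le_Suc_eq)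
  finally have "U b *v (transpose (U b) *v (?T *v (U (Suc b) *v ?z))) = ?T *v (U (Suc b) *v ?z)"
    using U Cons.prems by (intro orthonormal_kernel_basis_proj) auto
  moreover have "kernel_block U (\<lambda>k. subdiv_mask a (t k)) b \<epsilon> *v ?z =
    transpose (U b) *v (?T *v (U (Suc b) *v ?z))"
    by (simp add: kernel_block_def matrix_vector_mul_assoc matrix_mul_assoc)
  moreover have "U (Suc b) *v ?z =
    chron_prod (\<lambda>k. block_matrix (subdiv_mask a (t k))) (Suc b) w *v (U (Suc b + length w) *v y)"
    using Cons.prems by (intro Cons.IH) auto
  ultimately show ?case
    by (simp flip: matrix_vector_mul_assoc)
qed simp

text \<open>A norm on the kernel, where the fourth coordinate is minus the second. The weight 2
  compensates for the mask entry in \<open>[0,1]\<close>, which may be as large as 1: it sees a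
  coordinate of at most half the gauge.\<close>

definition ker_gauge :: "real^4 \<Rightarrow> real" where
  "ker_gauge v = max \<bar>v $ 1\<bar> (max (2 * \<bar>v $ 2\<bar>) \<bar>v $ 3\<bar>)"

text \<open>On the kernel the second coordinate is halved, the new third one is at most half the
  gauge, and the first one is \<open>a\<close> times an old coordinate; \<open>1/2 \<le> a\<close>
  makes \<open>a\<close> the common factor.\<close>

lemma ker_gauge_contract:
  assumes "1/2 \<le> a" "0 \<le> \<tau>" "\<tau> \<le> 1" "\<epsilon> \<in> {0, 1}" "v $ 4 = - v $ 2"
  shows "ker_gauge (block_matrix (subdiv_mask a \<tau>) \<epsilon> *v v) \<le> a * ker_gauge v"
proof -
  have gauge: "\<bar>v $ 1\<bar> \<le> ker_gauge v" "2 * \<bar>v $ 2\<bar> \<le> ker_gauge v" "\<bar>v $ 3\<bar> \<le> ker_gauge v"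
    by (auto simp: ker_gauge_def)
  have "1/2 * ker_gauge v \<le> a * ker_gauge v"
    using assms gauge by (intro mult_right_mono) auto
  then have v2: "\<bar>v $ 2\<bar> \<le> a * ker_gauge v"
    using gauge by linarith
  have "\<tau> * \<bar>v $ 2\<bar> \<le> \<bar>v $ 2\<bar>"
    using assms by (intro mult_left_le_one_le) auto
  then have t: "\<tau> * \<bar>v $ 2\<bar> \<le> a * ker_gauge v"
    using v2 by linarith
  have "a * \<bar>v $ 1\<bar> \<le> a * ker_gauge v" "a * \<bar>v $ 3\<bar> \<le> a * ker_gauge v"
    using assms gauge by (auto intro: mult_left_mono)
  then show ?thesis
    using assms v2 t by (auto simp: block_matrix_apply ker_gauge_def[of "vector _"] abs_mult)
qed

lemma ker_gauge_chron_prod: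
  assumes "1/2 \<le> a" "t \<in> unit_seqs" "b \<ge> 1" "set w \<subseteq> {0, 1}" "v $ 4 = - v $ 2"
  defines "z \<equiv> chron_prod (\<lambda>k. block_matrix (subdiv_mask a (t k))) b w *v v"
  shows "z $ 4 = - z $ 2 \<and> ker_gauge z \<le> a ^ length w * ker_gauge v"
  using assms(3,4) unfolding z_def
proof (induction w arbitrary: b)
  case Nil
  then show ?case using assms by simp
next
  case (Cons \<epsilon> w)
  let ?z = "chron_prod (\<lambda>k. block_matrix (subdiv_mask a (t k))) (Suc b) w *v v"
  have IH: "?z $ 4 = - ?z $ 2" "ker_gauge ?z \<le> a ^ length w * ker_gauge v"
    using Cons.IH[of "Suc b"] Cons.prems by auto
  have eps: "\<epsilon> \<in> {0, 1}" and "0 \<le> t b" "t b \<le> 1"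
    using Cons.prems assms(2) by (auto simp: unit_seqs_def)
  then have "ker_gauge (block_matrix (subdiv_mask a (t b)) \<epsilon> *v ?z) \<le> a * ker_gauge ?z"
    using IH assms(1) by (intro ker_gauge_contract) auto
  also have "\<dots> \<le> a * (a ^ length w * ker_gauge v)"
    using IH assms(1) by (intro mult_left_mono) auto
  finally have "ker_gauge (block_matrix (subdiv_mask a (t b)) \<epsilon> *v ?z) \<le> a ^ Suc (length w) * ker_gauge v"
    by (simp add: mult.assoc)
  moreover have "(block_matrix (subdiv_mask a (t b)) \<epsilon> *v ?z) $ 4 = - (block_matrix (subdiv_mask a (t b)) \<epsilon> *v ?z) $ 2"
    using eps IH by (auto simp: block_matrix_apply)
  ultimately show ?case
    by (simp add: matrix_vector_mul_assoc)
qed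

text \<open>The bases are isometries, so it suffices to compare the gauge with the Euclidean norm on
  the kernel: the gauge is at most twice the norm, and the norm at most three times the gauge,
  whence 6. What matters is that this constant is uniform in \<open>b\<close> and
  \<open>w\<close>.\<close>

lemma op_norm_chron_prod_le:
  fixes U :: "nat \<Rightarrow> real^'d^4"
  assumes U: "\<And>k. k \<ge> 1 \<Longrightarrow> orthonormal_kernel_basis match_map (U k)"
    and "1/2 \<le> a" "t \<in> unit_seqs" "b \<ge> 1" "set w \<subseteq> {0, 1}"
  shows "op_norm (chron_prod (kernel_block U (\<lambda>k. subdiv_mask a (t k))) b w) \<le> 6 * a ^ length w"
  unfolding op_norm_def
proof (rule onorm_le)
  fix y
  let ?M = "chron_prod (kernel_block U (\<lambda>k. subdiv_mask a (t k))) b w"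
  define v where "v = U (b + length w) *v y"
  define z where "z = chron_prod (\<lambda>k. block_matrix (subdiv_mask a (t k))) b w *v v"
  have "match_map *v v = 0"
    unfolding v_def using U assms by (intro orthonormal_kernel_basis_in_ker) auto
  then have v4: "v $ 4 = - v $ 2"
    by (simp add: match_map_ker)
  have z: "z $ 4 = - z $ 2" "ker_gauge z \<le> a ^ length w * ker_gauge v"
    using ker_gauge_chron_prod[of a t b w v] assms v4 by (auto simp: z_def)
  have "ker_gauge v \<le> 2 * norm v"
    using component_le_norm_cart[of v 1] component_le_norm_cart[of v 2] component_le_norm_cart[of v 3]
    unfolding ker_gauge_def max.bounded_iff by auto
  then have gv: "a ^ length w * ker_gauge v \<le> a ^ length w * (2 * norm v)"
    using assms by (intro mult_left_mono) auto
  have "norm (?M *v y) = norm z"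
    using orthonormal_kernel_basis_isometry[OF U[OF \<open>b \<ge> 1\<close>], of "?M *v y"]
      chron_prod_kernel_block[of U, OF U \<open>b \<ge> 1\<close> assms(5)]
    by (simp add: z_def v_def)
  also have "\<dots> \<le> (\<Sum>i\<in>UNIV. \<bar>z $ i\<bar>)"
    by (rule norm_le_l1_cart)
  also have "\<dots> \<le> 3 * ker_gauge z"
    using z(1) unfolding sum_4 ker_gauge_def by (simp add: max_def)
  also have "\<dots> \<le> 6 * a ^ length w * norm v"
    using z(2) gv by linarith
  also have "norm v = norm y"
    unfolding v_def using U assms by (intro orthonormal_kernel_basis_isometry[of match_map]) auto
  finally show "norm (?M *v y) \<le> 6 * a ^ length w * norm y" .
qed

text \<open>The first coordinate vector lies in the kernel and is an eigenvector for
  \<open>a\<close> of every block matrix with digit 0, whatever \<open>t\<close> is.\<close>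

lemma op_norm_chron_prod_zeros_ge:
  fixes U :: "nat \<Rightarrow> real^'d^4"
  assumes U: "\<And>k. k \<ge> 1 \<Longrightarrow> orthonormal_kernel_basis match_map (U k)"
    and "0 \<le> a" "b \<ge> 1"
  shows "a ^ m \<le> op_norm (chron_prod (kernel_block U (\<lambda>k. subdiv_mask a (t k))) b (replicate m 0))"
proof -
  let ?M = "chron_prod (kernel_block U (\<lambda>k. subdiv_mask a (t k))) b (replicate m 0)"
  define v :: "real^4" where "v = vector [1, 0, 0, 0]"
  have v: "match_map *v v = 0"
    by (simp add: match_map_ker v_def)
  have "v = axis 1 1"
    by (simp add: v_def vec_eq_iff forall_4 axis_def)
  then have norm_v: "norm v = 1"
    by (simp add: norm_axis_1)
  define y where "y = transpose (U (b + m)) *v v"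
  have y: "U (b + m) *v y = v"
    unfolding y_def using U assms v by (intro orthonormal_kernel_basis_proj) auto
  have norm_y: "norm y = 1"
    using orthonormal_kernel_basis_isometry[OF U, of "b + m" y] assms y norm_v by simp
  have eigen: "chron_prod (\<lambda>k. block_matrix (subdiv_mask a (t k))) c (replicate m 0) *v v = a ^ m *\<^sub>R v"
    for c m
  proof (induction m arbitrary: c)
    case (Suc m)
    have "block_matrix (subdiv_mask a (t c)) 0 *v v = a *\<^sub>R v"
      by (simp add: block_matrix_apply v_def vec_eq_iff forall_4)
    then show ?case
      by (simp add: Suc matrix_vector_mult_scaleR flip: matrix_vector_mul_assoc)
  qed simp
  have "norm (?M *v y) = norm (a ^ m *\<^sub>R v)"
    using orthonormal_kernel_basis_isometry[OF U[OF \<open>b \<ge> 1\<close>], of "?M *v y"]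
      chron_prod_kernel_block[of U b "replicate m 0" a t y, OF U \<open>b \<ge> 1\<close>] eigen[of b m] y
    by (simp add: set_replicate_conv_if)
  then have "a ^ m = norm (?M *v y)"
    using norm_v assms by simp
  also have "\<dots> \<le> op_norm ?M * norm y"
    unfolding op_norm_def by (intro onorm matrix_vector_mul_bounded_linear)
  finally show ?thesis
    using norm_y by simp
qed

lemma has_chron_radius_kernel_block:
  fixes U :: "nat \<Rightarrow> real^'d^4"
  assumes U: "\<And>k. k \<ge> 1 \<Longrightarrow> orthonormal_kernel_basis match_map (U k)"
    and a: "1/2 \<le> a" and t: "t \<in> unit_seqs"
  shows "has_chron_radius (kernel_block U (\<lambda>k. subdiv_mask a (t k))) a"
proof -
  let ?C = "kernel_block U (\<lambda>k. subdiv_mask a (t k))"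
  have fin: "finite {w. set w \<subseteq> {0, 1::int} \<and> length w = m}" for m
    by (intro finite_lists_length_eq) auto
  have zeros: "replicate m 0 \<in> {w. set w \<subseteq> {0, 1::int} \<and> length w = m}" for m
    by auto
  have up: "chron_max ?C m b \<le> 6 * a ^ m" if "b \<ge> 1" for m b
    unfolding chron_max_def
  proof (rule Max.boundedI)
    fix r
    assume "r \<in> (\<lambda>w. op_norm (chron_prod ?C b w)) ` {w. set w \<subseteq> {0, 1} \<and> length w = m}"
    then obtain w where "r = op_norm (chron_prod ?C b w)" "set w \<subseteq> {0, 1}" "length w = m"
      by blast
    then show "r \<le> 6 * a ^ m"
      using op_norm_chron_prod_le[of U a t b w, OF U a t that] by simp
  qed (use fin zeros in blast)+
  have lo: "a ^ m \<le> chron_max ?C m b" if "b \<ge> 1" for m b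
  proof -
    have "a ^ m \<le> op_norm (chron_prod ?C b (replicate m 0))"
      using a by (intro op_norm_chron_prod_zeros_ge U that) auto
    also have "\<dots> \<le> chron_max ?C m b"
      unfolding chron_max_def using fin zeros by (intro Max_ge finite_imageI imageI)
    finally show ?thesis .
  qed
  have bdd: "bdd_above (chron_max ?C m ` {1..})" for m
    using up by (intro bdd_aboveI2[where M = "6 * a ^ m"]) auto
  define X where "X m = (SUP b\<in>{1..}. chron_max ?C m b)" for m
  have "X m \<le> 6 * a ^ m" for m
    unfolding X_def using up by (intro cSUP_least) auto
  moreover have "a ^ m \<le> X m" for m
  proof -
    have "a ^ m \<le> chron_max ?C m 1"
      using lo by simp
    also have "\<dots> \<le> X m"
      unfolding X_def by (intro cSUP_upper bdd) simp
    finally show ?thesis .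
  qed
  moreover have "root m (a ^ m) = a" if "m > 0" for m
    using that a by (intro real_root_power_cancel) auto
  \<comment> \<open>The case \<open>m = 0\<close> is excluded because \<open>root 0\<close> takes
    the default value 0.\<close>
  ultimately have sandwich: "a \<le> root m (X m)" "root m (X m) \<le> root m 6 * a" if "m > 0" for m
    using that by (metis real_root_le_mono, metis real_root_le_mono real_root_mult)
  have "(\<lambda>m. root m 6 * a) \<longlonglongrightarrow> 1 * a"
    by (intro tendsto_mult LIMSEQ_root_const tendsto_const) auto
  then have lim: "(\<lambda>m. root m 6 * a) \<longlonglongrightarrow> a"
    by simp
  have "(\<lambda>m. root m (X m)) \<longlonglongrightarrow> a"
  proof (rule tendsto_sandwich[OF _ _ tendsto_const lim])
    show "\<forall>\<^sub>F m in sequentially. a \<le> root m (X m)"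
      using eventually_gt_at_top[of 0] by eventually_elim (rule sandwich)
    show "\<forall>\<^sub>F m in sequentially. root m (X m) \<le> root m 6 * a"
      using eventually_gt_at_top[of 0] by eventually_elim (rule sandwich)
  qed
  then show ?thesis
    using bdd unfolding has_chron_radius_def X_def by blast
qed

subsection \<open>Covering numbers\<close>

definition is_cover :: "real \<Rightarrow> (real \<Rightarrow> 'a::euclidean_space) set \<Rightarrow> (real \<Rightarrow> 'a) set \<Rightarrow> bool" where
  "is_cover \<epsilon> F S \<longleftrightarrow> finite S \<and> (\<forall>c\<in>S. bounded (range c)) \<and>
     (\<forall>f\<in>F. \<exists>c\<in>S. sup_norm (\<lambda>x. f x - c x) \<le> ereal \<epsilon>)"

lemma covering_number_eq: "covering_number \<epsilon> F = (INF S\<in>{S. is_cover \<epsilon> F S}. enat (card S))"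
proof -
  have "F \<subseteq> (\<Union>c\<in>S. {f. sup_norm (\<lambda>x. f x - c x) \<le> ereal \<epsilon>}) \<longleftrightarrow>
    (\<forall>f\<in>F. \<exists>c\<in>S. sup_norm (\<lambda>x. f x - c x) \<le> ereal \<epsilon>)" for S
    by auto
  then show ?thesis
    by (simp add: covering_number_def is_cover_def)
qed

lemma covering_number_le: "is_cover \<epsilon> F S \<Longrightarrow> covering_number \<epsilon> F \<le> enat (card S)"
  unfolding covering_number_eq by (rule INF_lower) auto

lemma covering_number_ge:
  "(\<And>S. is_cover \<epsilon> F S \<Longrightarrow> n \<le> enat (card S)) \<Longrightarrow> n \<le> covering_number \<epsilon> F"
  unfolding covering_number_eq by (rule INF_greatest) auto

text \<open>A ball of radius \<open>\<epsilon>\<close> around any center holds at most one member of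
  a family separated by more than \<open>2 * \<epsilon>\<close>, so choosing a center for each index
  is injective.\<close>

lemma covering_number_ge_packing:
  fixes f :: "'i \<Rightarrow> real \<Rightarrow> 'a::euclidean_space"
  assumes I: "\<And>i. i \<in> I \<Longrightarrow> f i \<in> F"
    and sep: "\<And>i j. i \<in> I \<Longrightarrow> j \<in> I \<Longrightarrow> i \<noteq> j \<Longrightarrow> \<not> sup_norm (\<lambda>x. f i x - f j x) \<le> ereal (2 * \<epsilon>)"
  shows "enat (card I) \<le> covering_number \<epsilon> F"
proof (rule covering_number_ge)
  fix S
  assume S: "is_cover \<epsilon> F S"
  then have "\<forall>i\<in>I. \<exists>c\<in>S. sup_norm (\<lambda>x. f i x - c x) \<le> ereal \<epsilon>"
    using I by (auto simp: is_cover_def)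
  then obtain c where c: "\<And>i. i \<in> I \<Longrightarrow> c i \<in> S"
    "\<And>i. i \<in> I \<Longrightarrow> sup_norm (\<lambda>x. f i x - c i x) \<le> ereal \<epsilon>"
    by metis
  have "inj_on c I"
  proof (rule inj_onI, rule ccontr)
    fix i j
    assume ij: "i \<in> I" "j \<in> I" "c i = c j" "i \<noteq> j"
    have "infnorm (f i x - f j x) \<le> 2 * \<epsilon>" for x
    proof -
      have "infnorm (f i x - f j x) = infnorm ((f i x - c i x) + (c j x - f j x))"
        using ij by simp
      also have "\<dots> \<le> infnorm (f i x - c i x) + infnorm (c j x - f j x)"
        by (rule infnorm_triangle)
      also have "infnorm (c j x - f j x) = infnorm (f j x - c j x)"
        by (rule infnorm_sub)
      also have "infnorm (f i x - c i x) + infnorm (f j x - c j x) \<le> 2 * \<epsilon>"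
        using c(2)[OF ij(1)] c(2)[OF ij(2)] unfolding sup_norm_le_iff by (metis add_mono mult_2)
      finally show ?thesis .
    qed
    then show False
      using sep ij by (auto simp: sup_norm_le_iff)
  qed
  moreover have "c ` I \<subseteq> S" "finite S"
    using c S by (auto simp: is_cover_def)
  ultimately show "enat (card I) \<le> enat (card S)"
    by (simp add: card_inj_on_le)
qed

section \<open>Entropy bounds from covers and codes\<close>

lemma entropy_le:
  assumes "covering_number \<epsilon> F \<le> enat n" "F \<noteq> {}"
  shows "entropy \<epsilon> F \<le> ereal (log 2 (real n))"
proof -
  \<comment> \<open>A nonempty class needs at least one ball, so the logarithm is taken at a
    positive number, where it is monotone.\<close>
  have "is_cover \<epsilon> F S \<Longrightarrow> 1 \<le> enat (card S)" for S
    using assms(2) by (auto simp: is_cover_def one_enat_def Suc_le_eq card_gt_0_iff)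
  then have "1 \<le> covering_number \<epsilon> F"
    by (rule covering_number_ge)
  then obtain m where m: "covering_number \<epsilon> F = enat m" "1 \<le> m" "m \<le> n"
    using assms by (cases "covering_number \<epsilon> F") (auto simp: one_enat_def)
  then show ?thesis
    by (simp add: entropy_def)
qed

lemma entropy_ge:
  assumes "enat n \<le> covering_number \<epsilon> F" "0 < n"
  shows "ereal (log 2 (real n)) \<le> entropy \<epsilon> F"
  using assms by (cases "covering_number \<epsilon> F") (auto simp: entropy_def)

text \<open>The reconstructions of all \<open>2 ^ B\<close> words form a cover. This serves twice:
  the quantiser bounds the entropy from above, and the entropy bounds the length of every code from
  below.\<close>

lemma entropy_le_code_length:
  assumes "fixed_length_code F B E R" "distortion F E R \<le> ereal \<epsilon>" "F \<noteq> {}"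
  shows "entropy \<epsilon> F \<le> ereal (real B)"
proof -
  let ?W = "{w :: bool list. length w = B}"
  have words: "finite ?W" "card ?W = 2 ^ B"
    using finite_lists_length_eq[of "UNIV :: bool set" B] card_lists_length_eq[of "UNIV :: bool set" B]
    by auto
  have "is_cover \<epsilon> F (R ` ?W)"
    unfolding is_cover_def
  proof (intro conjI ballI)
    fix f
    assume f: "f \<in> F"
    have "sup_norm (\<lambda>x. f x - R (E f) x) \<le> distortion F E R"
      unfolding distortion_def using f by (rule SUP_upper)
    then show "\<exists>c\<in>R ` ?W. sup_norm (\<lambda>x. f x - c x) \<le> ereal \<epsilon>"
      using f assms by (intro bexI[of _ "R (E f)"]) (auto simp: fixed_length_code_def)
  qed (use words assms in \<open>auto simp: fixed_length_code_def\<close>)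
  then have "covering_number \<epsilon> F \<le> enat (card (R ` ?W))"
    by (rule covering_number_le)
  also have "\<dots> \<le> enat (2 ^ B)"
    using card_image_le[OF words(1), of R] words(2) by simp
  finally have "entropy \<epsilon> F \<le> ereal (log 2 (real (2 ^ B)))"
    using assms(3) by (rule entropy_le)
  then show ?thesis
    by simp
qed

text \<open>All members of the vector class share the second component \<open>hat\<close>. Centers
  are lifted by appending it exactly and projected to their first coordinate; neither operation
  enlarges the maximum-norm error or the number of centers.\<close>

lemma entropy_Phi_eq:
  assumes "0 < \<epsilon>"
  shows "entropy \<epsilon> (Phi a ` T) = entropy \<epsilon> (phi a ` T)"
proof -
  have "covering_number \<epsilon> (Phi a ` T) = covering_number \<epsilon> (phi a ` T)"
  proof (rule antisym)
    show "covering_number \<epsilon> (Phi a ` T) \<le> covering_number \<epsilon> (phi a ` T)"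
    proof (rule covering_number_ge)
      fix S
      assume S: "is_cover \<epsilon> (phi a ` T) S"
      define lift where "lift c x = (vector [c x, hat x] :: real^2)" for c :: "real \<Rightarrow> real" and x
      have "is_cover \<epsilon> (Phi a ` T) (lift ` S)"
        unfolding is_cover_def
      proof (intro conjI ballI)
        fix c
        assume "c \<in> lift ` S"
        then obtain d where d: "d \<in> S" "c = lift d" by blast
        then obtain M where M: "\<And>x. \<bar>d x\<bar> \<le> M"
          using S by (force simp: is_cover_def bounded_iff)
        have "norm (c x) \<le> M + 1" for x
          using norm_le_l1_cart[of "c x"] M[of x] hat_nonneg[of x] hat_le_1[of x]
          by (simp add: d lift_def sum_2)
        then show "bounded (range c)"
          by (auto simp: bounded_iff)
      next
        fix f
        assume "f \<in> Phi a ` T"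
        then obtain t where t: "t \<in> T" "f = Phi a t" by blast
        then obtain d where "d \<in> S" "sup_norm (\<lambda>x. phi a t x - d x) \<le> ereal \<epsilon>"
          using S by (auto simp: is_cover_def)
        then show "\<exists>c\<in>lift ` S. sup_norm (\<lambda>x. f x - c x) \<le> ereal \<epsilon>"
          using assms
          by (auto simp: t Phi_def lift_def sup_norm_le_iff infnorm_2 infnorm_real intro!: bexI[of _ d])
      qed (use S in \<open>auto simp: is_cover_def\<close>)
      then have "covering_number \<epsilon> (Phi a ` T) \<le> enat (card (lift ` S))"
        by (rule covering_number_le)
      also have "\<dots> \<le> enat (card S)"
        using S by (simp add: is_cover_def card_image_le)
      finally show "covering_number \<epsilon> (Phi a ` T) \<le> enat (card S)" .
    qed
    show "covering_number \<epsilon> (phi a ` T) \<le> covering_number \<epsilon> (Phi a ` T)"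
    proof (rule covering_number_ge)
      fix S
      assume S: "is_cover \<epsilon> (Phi a ` T) S"
      define proj where "proj c x = c x $ 1" for c :: "real \<Rightarrow> real^2" and x
      have "is_cover \<epsilon> (phi a ` T) (proj ` S)"
        unfolding is_cover_def
      proof (intro conjI ballI)
        fix c
        assume "c \<in> proj ` S"
        then obtain d where d: "d \<in> S" "c = proj d" by blast
        then obtain M where M: "\<And>x. norm (d x) \<le> M"
          using S by (force simp: is_cover_def bounded_iff)
        have "\<bar>c x\<bar> \<le> M" for x
          using component_le_norm_cart[of "d x" 1] M[of x] by (simp add: d proj_def)
        then show "bounded (range c)"
          by (auto simp: bounded_iff)
      next
        fix f
        assume "f \<in> phi a ` T"
        then obtain t where t: "t \<in> T" "f = phi a t" by blast
        then obtain d where "d \<in> S" "sup_norm (\<lambda>x. Phi a t x - d x) \<le> ereal \<epsilon>"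
          using S by (auto simp: is_cover_def)
        then show "\<exists>c\<in>proj ` S. sup_norm (\<lambda>x. f x - c x) \<le> ereal \<epsilon>"
          by (auto simp: t Phi_def proj_def sup_norm_le_iff infnorm_2 infnorm_real intro!: bexI[of _ d])
      qed (use S in \<open>auto simp: is_cover_def\<close>)
      then have "covering_number \<epsilon> (phi a ` T) \<le> enat (card (proj ` S))"
        by (rule covering_number_le)
      also have "\<dots> \<le> enat (card S)"
        using S by (simp add: is_cover_def card_image_le)
      finally show "covering_number \<epsilon> (phi a ` T) \<le> enat (card S)" .
    qed
  qed
  then show ?thesis
    by (simp add: entropy_def)
qed

section \<open>Lower bound for the entropy by a grid packing\<close>

lemma sum_arith_progression:
  fixes c l :: real
  shows "(\<Sum>k<n. c - real k * l) = real n * c - l * real n * (real n - 1) / 2"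
  by (induction n) (auto simp: field_simps)

text \<open>A product grid in the box: after scaling by \<open>a ^ k\<close> the spacing in each of
  the first \<open>n\<close> coordinates is \<open>3 * \<epsilon>\<close>, which exceeds
  \<open>2 * \<epsilon>\<close>. The number \<open>n\<close> stays free and is optimised
  later.\<close>

lemma entropy_lower_packing:
  assumes a: "0 < a" "a < 1" and "0 < \<epsilon>"
  shows "ereal (\<Sum>k<n. log 2 (1/\<epsilon>) - log 2 3 - real k * log 2 (1/a)) \<le> entropy \<epsilon> (phi a ` unit_seqs)"
proof -
  \<comment> \<open>The last grid index that stays in the unit interval. Counting index 0 as well
    gives \<open>m k + 1\<close> points, which absorbs the loss from the floor.\<close>
  define m where "m k = nat \<lfloor>a ^ k / (3 * \<epsilon>)\<rfloor>" for k
  define I where "I = (\<Pi>\<^sub>E k\<in>{..<n}. {..m k})"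
  \<comment> \<open>Grid indices start at 0 and sequences at 1, hence the shift.\<close>
  define u where "u i k = (if k \<in> {1..n} then real (i (k - 1)) * (3 * \<epsilon> / a ^ (k - 1)) else 0)"
    for i :: "nat \<Rightarrow> nat" and k
  have m_le: "real (m k) \<le> a ^ k / (3 * \<epsilon>)" and m_ge: "a ^ k / (3 * \<epsilon>) \<le> real (m k + 1)" for k
    using assms by (auto simp: m_def le_nat_floor) linarith+
  have u_unit: "u i \<in> unit_seqs" if "i \<in> I" for i
  proof -
    have "real (i k) * (3 * \<epsilon> / a ^ k) \<le> 1" if "k < n" for k
    proof -
      have "real (i k) \<le> a ^ k / (3 * \<epsilon>)"
        using \<open>i \<in> I\<close> that order_trans[OF of_nat_mono m_le] by (auto simp: I_def PiE_iff)
      then show ?thesis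
        using assms by (simp add: field_simps)
    qed
    then show ?thesis
      using assms by (auto simp: unit_seqs_def u_def)
  qed
  have "enat (card I) \<le> covering_number \<epsilon> (phi a ` unit_seqs)"
  proof (rule covering_number_ge_packing[where f = "\<lambda>i. phi a (u i)"])
    fix i j
    assume ij: "i \<in> I" "j \<in> I" "i \<noteq> j"
    then obtain k where k: "k < n" "i k \<noteq> j k"
      unfolding I_def by (metis PiE_ext lessThan_iff)
    have "3 * \<epsilon> * 1 \<le> 3 * \<epsilon> * \<bar>real (i k) - real (j k)\<bar>"
      using k assms by (intro mult_left_mono) linarith+
    also have "\<dots> = a ^ k * \<bar>u i (Suc k) - u j (Suc k)\<bar>"
    proof -
      have "u i (Suc k) - u j (Suc k) = (real (i k) - real (j k)) * (3 * \<epsilon> / a ^ k)"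
        using k by (simp add: u_def left_diff_distrib diff_divide_distrib)
      then show ?thesis
        using assms by (simp add: abs_mult)
    qed
    finally have "ereal (3 * \<epsilon>) \<le> ereal (a ^ (Suc k - 1) * \<bar>u i (Suc k) - u j (Suc k)\<bar>)"
      by simp
    also have "\<dots> \<le> sup_norm (\<lambda>x. phi a (u i) x - phi a (u j) x)"
      unfolding sup_norm_phi_diff[OF a u_unit[OF ij(1)] u_unit[OF ij(2)]] by (rule SUP_upper) auto
    finally have "ereal (3 * \<epsilon>) \<le> sup_norm (\<lambda>x. phi a (u i) x - phi a (u j) x)" .
    moreover have "ereal (2 * \<epsilon>) < ereal (3 * \<epsilon>)"
      using assms by simp
    ultimately show "\<not> sup_norm (\<lambda>x. phi a (u i) x - phi a (u j) x) \<le> ereal (2 * \<epsilon>)"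
      by (meson leD order_less_le_trans)
  qed (use u_unit in auto)
  moreover have card: "card I = (\<Prod>k<n. m k + 1)"
    by (simp add: I_def card_PiE)
  moreover have pos: "0 < card I"
    unfolding card by (intro prod_pos) auto
  ultimately have "ereal (log 2 (real (card I))) \<le> entropy \<epsilon> (phi a ` unit_seqs)"
    by (intro entropy_ge)
  moreover have "(\<Sum>k<n. log 2 (1/\<epsilon>) - log 2 3 - real k * log 2 (1/a)) \<le> log 2 (real (card I))"
  proof -
    have "(\<Sum>k<n. log 2 (1/\<epsilon>) - log 2 3 - real k * log 2 (1/a)) = (\<Sum>k<n. log 2 (a ^ k / (3 * \<epsilon>)))"
      using assms by (intro sum.cong) (auto simp: log_divide log_mult log_nat_power)
    also have "\<dots> \<le> (\<Sum>k<n. log 2 (real (m k + 1)))"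
      using assms m_ge by (intro sum_mono) (auto simp del: of_nat_add)
    also have "\<dots> = log 2 (real (card I))"
      unfolding card of_nat_prod log_def by (subst ln_prod) (auto simp: sum_divide_distrib)
    finally show ?thesis .
  qed
  ultimately show ?thesis
    by (metis ereal_less_eq(3) order_trans)
qed

subsection \<open>ReLU realisation of finite sums\<close>

text \<open>The state for \<open>k = 0\<close>, with scale \<open>2 ^ Suc 0\<close>; the zero row
  initialises the accumulator. Since all thresholds are nonnegative, rectification makes the state a
  function of \<open>max x 0\<close>.\<close>

definition first_layer :: affine where
  "first_layer = ([[2], [2], [2], [2], [0]], [0, -2, -3, -4, 0])"

text \<open>The scale doubles and the new ramps are formed from it alone. The last row adds
  \<open>c\<close> times the hat built from the old ramps, with the coefficients 1, -2, 1 of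
  \<open>hat_relu\<close>.\<close>

definition step_layer :: "real \<Rightarrow> affine" where
  "step_layer c =
    ([[2, 0, 0, 0, 0], [2, 0, 0, 0, 0], [2, 0, 0, 0, 0], [2, 0, 0, 0, 0], [0, c, -2 * c, c, 1]],
     [0, -2, -3, -4, 0])"

definition out_layer :: "real \<Rightarrow> affine" where
  "out_layer c = ([[0, c, -2 * c, c, 1]], [0])"

text \<open>With \<open>y = max x 0\<close>, the hidden layer number \<open>k\<close> holds
  \<open>2 ^ k * y\<close>, the three rectified ramps whose combination is \<open>hat (2 ^ k * y - 2)\<close>,
  and the partial sum of the previous terms, which is nonnegative and hence
  unaffected by the activation.\<close>

definition phi_net :: "real \<Rightarrow> (nat \<Rightarrow> real) \<Rightarrow> nat \<Rightarrow> network" where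
  "phi_net a u n = (first_layer # map (\<lambda>k. step_layer (a ^ k * u (Suc k))) [0..<n],
                    out_layer (a ^ n * u (Suc n)))"

text \<open>The hidden layers for \<open>n\<close> are a prefix of those for \<open>Suc n\<close>,
  which drives the induction. The sum lags one term behind the ramps: these are combined only by the
  next step layer or the output layer.\<close>

lemma phi_net_hidden_state:
  fixes x :: real
  assumes "0 \<le> a" "\<And>k. 0 \<le> u (Suc k)"
  defines "y \<equiv> max x 0"
  shows "fold (\<lambda>H u. map (\<lambda>y. max y 0) (affine_apply H u)) (fst (phi_net a u n)) [x] =
    [2 ^ Suc n * y, max (2 ^ Suc n * y - 2) 0, max (2 ^ Suc n * y - 3) 0, max (2 ^ Suc n * y - 4) 0,
     \<Sum>k<n. a ^ k * u (Suc k) * hat (2 ^ Suc k * y - 2)]"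
proof (induction n)
  case 0
  show ?case
    by (auto simp: phi_net_def first_layer_def affine_apply_def y_def max_def)
next
  case (Suc n)
  define s where "s = (\<Sum>k<n. a ^ k * u (Suc k) * hat (2 ^ Suc k * y - 2))"
  define z where "z = 2 ^ Suc n * y"
  define c where "c = a ^ n * u (Suc n)"
  have fold: "fold (\<lambda>H u. map (\<lambda>y. max y 0) (affine_apply H u)) (fst (phi_net a u (Suc n))) [x] =
    map (\<lambda>y. max y 0) (affine_apply (step_layer c)
      [z, max (z - 2) 0, max (z - 3) 0, max (z - 4) 0, s])"
    using Suc by (simp add: phi_net_def s_def z_def c_def)
  have nonneg: "0 \<le> z" "0 \<le> s + c * hat (z - 2)"
    unfolding z_def s_def c_def y_def using assms hat_nonneg
    by (auto intro!: add_nonneg_nonneg sum_nonneg mult_nonneg_nonneg)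
  have "c * max (z - 2) 0 + (- (2 * c * max (z - 3) 0) + (c * max (z - 4) 0 + s)) = s + c * hat (z - 2)"
    by (simp add: hat_relu algebra_simps)
  then have "affine_apply (step_layer c) [z, max (z - 2) 0, max (z - 3) 0, max (z - 4) 0, s] =
    [2 * z, 2 * z - 2, 2 * z - 3, 2 * z - 4, s + c * hat (z - 2)]"
    by (simp add: step_layer_def affine_apply_def)
  then show ?case
    unfolding fold using nonneg by (simp add: s_def z_def c_def mult.assoc)
qed

lemma hidden_ok_uniform:
  assumes "\<And>H. H \<in> set Hs \<Longrightarrow> affine_ok d H \<and> out_dim H = d" "affine_ok d L" "out_dim L = e"
  shows "hidden_ok d Hs L e"
  using assms by (induction Hs) auto

lemma computes_phi_net:
  assumes "0 \<le> a" "\<And>k. 0 \<le> u (Suc k)" "\<And>k. k > n \<Longrightarrow> u (Suc k) = 0"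
  shows "computes (phi_net a u n) (phi a u)"
  unfolding computes_def
proof
  show "network_ok 1 1 (phi_net a u n)"
    by (auto simp: network_ok_def phi_net_def first_layer_def step_layer_def out_layer_def
        affine_ok_def out_dim_def intro!: hidden_ok_uniform)
  show "\<forall>x. network_eval (phi_net a u n) [x] = [phi a u x]"
  proof
    fix x :: real
    define y where "y = max x 0"
    define z where "z = 2 ^ Suc n * y"
    define c where "c = a ^ n * u (Suc n)"
    define s where "s = (\<Sum>k<n. a ^ k * u (Suc k) * hat (2 ^ Suc k * y - 2))"
    \<comment> \<open>Replacing \<open>x\<close> by \<open>max x 0\<close> is harmless because every
      bump vanishes on the negative half-line.\<close>
    have hat_y: "hat (2 ^ Suc k * y - 2) = hat (2 ^ Suc k * x - 2)" for k
    proof (cases "x \<ge> 0")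
      case False
      then have "2 ^ Suc k * x \<le> 0"
        by (intro mult_nonneg_nonpos) auto
      then show ?thesis
        using False by (simp add: y_def hat_eq_0 del: power_Suc)
    qed (simp add: y_def)
    have "network_eval (phi_net a u n) [x] =
      affine_apply (out_layer c) [z, max (z - 2) 0, max (z - 3) 0, max (z - 4) 0, s]"
      using phi_net_hidden_state[of a u n x, OF assms(1,2)]
      by (simp add: network_eval_def phi_net_def z_def s_def y_def c_def)
    also have "\<dots> = [s + c * hat (z - 2)]"
      by (simp add: out_layer_def affine_apply_def hat_relu algebra_simps)
    also have "s + c * hat (z - 2) = (\<Sum>k<Suc n. a ^ k * u (Suc k) * hat (2 ^ Suc k * y - 2))"
      by (simp add: s_def c_def z_def)
    also have "\<dots> = phi a u x"
      unfolding hat_y using assms(3) by (intro phi_partial_sum[symmetric]) auto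
    finally show "network_eval (phi_net a u n) [x] = [phi a u x]" .
  qed
qed

text \<open>The first layer has 5 + 5 entries, each step layer 25 + 5 and the output layer 5 +
  1.\<close>

lemma phi_net_size:
  "network_depth (phi_net a u n) = n + 1"
  "network_width (phi_net a u n) \<le> 5"
  "length (network_params (phi_net a u n)) = 30 * n + 16"
proof -
  show "network_depth (phi_net a u n) = n + 1"
    by (simp add: network_depth_def phi_net_def)
  show "network_width (phi_net a u n) \<le> 5"
    unfolding network_width_def
    by (rule Max.boundedI) (auto simp: phi_net_def first_layer_def step_layer_def out_dim_def)
  show "length (network_params (phi_net a u n)) = 30 * n + 16"
    by (simp add: network_params_def phi_net_def length_concat comp_def affine_entries_def
        first_layer_def step_layer_def out_layer_def sum_list_triv)
qed

lemma phi_net_rational: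
  assumes "a \<in> \<rat>" "\<And>k. u (Suc k) \<in> \<rat>"
  shows "set (network_params (phi_net a u n)) \<subseteq> \<rat>"
  using assms
  by (auto simp: network_params_def phi_net_def affine_entries_def
      first_layer_def step_layer_def out_layer_def)

subsection \<open>Quantisation\<close>

text \<open>One extra bit per coordinate pays for rounding up. Completing the square about
  \<open>L / l\<close> isolates the leading term; the rest is linear in \<open>n\<close>, hence in
  \<open>L\<close> because \<open>1 \<le> L\<close>.\<close>

lemma bit_sum_le:
  fixes L l :: real
  assumes "1 \<le> L" "0 < l"
  defines "n \<equiv> nat \<lceil>L / l\<rceil>"
  shows "(\<Sum>k<n. L + 1 - real k * l) \<le> L\<^sup>2 / (2 * l) + (l / 2 + 1) * (1 / l + 1) * L"
proof -
  define q where "q = real n"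
  have pos: "0 < L / l"
    using assms by simp
  have q: "q \<le> L / l + 1" "0 \<le> q"
    unfolding q_def n_def using pos by linarith+
  then have "q \<le> (1 / l + 1) * L"
    using assms(1) by (simp add: distrib_right)
  then have lin: "(l / 2 + 1) * q \<le> (l / 2 + 1) * ((1 / l + 1) * L)"
    using assms by (intro mult_left_mono) auto
  have "(\<Sum>k<n. L + 1 - real k * l) = q * L - l * q\<^sup>2 / 2 + (l / 2 + 1) * q"
    unfolding sum_arith_progression q_def by (simp add: field_simps power2_eq_square)
  also have "q * L - l * q\<^sup>2 / 2 = L\<^sup>2 / (2 * l) - l / 2 * (q - L / l)\<^sup>2"
    using assms by (simp add: field_simps power2_eq_square)
  also have "\<dots> + (l / 2 + 1) * q \<le> L\<^sup>2 / (2 * l) + (l / 2 + 1) * (1 / l + 1) * L"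
  proof -
    have "0 \<le> l / 2 * (q - L / l)\<^sup>2"
      using assms by simp
    then show ?thesis
      using lin unfolding mult.assoc by linarith
  qed
  finally show ?thesis .
qed

text \<open>The square about \<open>L / l\<close> now has the unfavourable sign, but the floor keeps
  \<open>n\<close> within distance 1 of \<open>L / l\<close>, so the square costs at most
  \<open>l / 2\<close>. The spacing factor 3 costs at most 2 bits per coordinate.\<close>

lemma packing_sum_ge:
  fixes L l :: real
  assumes "1 \<le> L" "0 < l"
  defines "n \<equiv> nat \<lfloor>L / l\<rfloor>"
  shows "L\<^sup>2 / (2 * l) - (l / 2 + 2 / l) * L \<le> (\<Sum>k<n. L - log 2 3 - real k * l)"
proof -
  define q where "q = real n"
  have pos: "0 < L / l"
    using assms by simp
  have q: "q \<le> L / l" "L / l - 1 \<le> q" "0 \<le> q"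
    unfolding q_def n_def using pos by linarith+
  have "log 2 3 \<le> log 2 (2 ^ 2 :: real)"
    by (subst log_le_cancel_iff) auto
  also have "\<dots> = 2"
    by (subst log_nat_power) auto
  finally have "q * log 2 3 \<le> L / l * 2"
    using q pos by (intro mult_mono) auto
  moreover have "(q - L / l)\<^sup>2 \<le> 1"
    using q by (subst abs_square_le_1) auto
  then have "l / 2 * (q - L / l)\<^sup>2 \<le> l / 2 * L"
    using assms by (intro mult_left_mono) auto
  moreover have "(\<Sum>k<n. L - log 2 3 - real k * l) =
      L\<^sup>2 / (2 * l) - l / 2 * (q - L / l)\<^sup>2 + l / 2 * q - q * log 2 3"
    unfolding sum_arith_progression q_def using assms by (simp add: field_simps power2_eq_square)
  moreover have "0 \<le> l / 2 * q"
    using assms q by simp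
  moreover have "(l / 2 + 2 / l) * L = l / 2 * L + L / l * 2"
    by (simp add: algebra_simps)
  ultimately show ?thesis
    by linarith
qed

lemma quantise_unit_interval:
  fixes x :: real
  assumes "0 \<le> x" "x \<le> 1"
  obtains i :: nat where "i < 2 ^ b" "\<bar>x - real i / 2 ^ b\<bar> \<le> 1 / 2 ^ b"
proof (cases "x = 1")
  \<comment> \<open>Rounding down would send the right endpoint to \<open>2 ^ b\<close>, which has
    no \<open>b\<close>-bit index; it joins the last cell.\<close>
  case True
  show thesis
  proof (rule that)
    show "2 ^ b - 1 < (2 ^ b :: nat)" by simp
    show "\<bar>x - real (2 ^ b - 1) / 2 ^ b\<bar> \<le> 1 / 2 ^ b"
      using True by (simp add: of_nat_diff diff_divide_distrib)
  qed
next
  case False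
  define i where "i = nat \<lfloor>x * 2 ^ b\<rfloor>"
  have "0 \<le> x * 2 ^ b" "x * 2 ^ b < 2 ^ b"
    using assms False by auto
  then have i: "real i \<le> x * 2 ^ b" "x * 2 ^ b < real i + 1" "real i < 2 ^ b"
    unfolding i_def by linarith+
  have "x - real i / 2 ^ b = (x * 2 ^ b - real i) / 2 ^ b"
    by (simp add: diff_divide_distrib)
  then have "\<bar>x - real i / 2 ^ b\<bar> = (x * 2 ^ b - real i) / 2 ^ b"
    using i by simp
  also have "\<dots> \<le> 1 / 2 ^ b"
    using i by (intro divide_right_mono) auto
  finally show thesis
    using i by (intro that[of i]) (auto simp: of_nat_less_numeral_power_cancel_iff)
qed

text \<open>Coordinates are rounded with just enough bits for a scaled error of at most
  \<open>\<epsilon>\<close>; those beyond \<open>n\<close> are set to 0, which is allowed since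
  their scale is already at most \<open>\<epsilon>\<close>.\<close>

lemma quantisation_code:
  assumes a: "0 < a" "a < 1" and \<epsilon>: "0 < \<epsilon>" and L: "1 \<le> log 2 (1/\<epsilon>)"
  defines "l \<equiv> log 2 (1/a)" and "n \<equiv> nat \<lceil>log 2 (1/\<epsilon>) / log 2 (1/a)\<rceil>"
  obtains B E R where "fixed_length_code (phi a ` unit_seqs) B E R"
    "distortion (phi a ` unit_seqs) E R \<le> ereal \<epsilon>"
    "real B \<le> (log 2 (1/\<epsilon>))\<^sup>2 / (2 * l) + (l / 2 + 1) * (1 / l + 1) * log 2 (1/\<epsilon>)"
    "\<And>w. length w = B \<Longrightarrow> \<exists>u\<in>unit_seqs. (\<forall>k>n. u k = 0) \<and> (\<forall>k\<ge>1. u k \<in> dyadics) \<and> R w = phi a u"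
proof -
  define L where "L = log 2 (1/\<epsilon>)"
  have l: "0 < l"
    unfolding l_def using a by simp
  have L1: "1 \<le> L"
    using L by (simp add: L_def)
  \<comment> \<open>By \<open>scale\<close> below, \<open>a ^ k / \<epsilon>\<close> is 2 to the
    power \<open>L - real k * l\<close>; its exponent is the bit demand of coordinate
    \<open>k + 1\<close>.\<close>
  define b where "b k = nat \<lceil>L - real k * l\<rceil>" for k
  define B where "B = (\<Sum>k<n. b k)"
  have scale: "a ^ k = \<epsilon> * 2 powr (L - real k * l)" for k
  proof -
    have "2 powr (L - real k * l) = 2 powr L / (2 powr l) ^ k"
      by (simp add: powr_diff powr_powr[symmetric] powr_realpow mult.commute[of "real k"])
    then show ?thesis
      using a \<epsilon> by (simp add: L_def l_def power_one_over)
  qed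
  have head: "a ^ k / 2 ^ b k \<le> \<epsilon>" for k
  proof -
    have "2 powr (L - real k * l) \<le> 2 powr real (b k)"
      unfolding b_def by (intro powr_mono) linarith+
    then have "2 powr (L - real k * l) \<le> 2 ^ b k"
      by (simp add: powr_realpow)
    then show ?thesis
      using \<epsilon> by (simp add: scale divide_le_eq)
  qed
  have n_ge: "L / l \<le> real n" and n_le: "real n \<le> L / l + 1"
    using l L1 divide_pos_pos[of L l] unfolding n_def l_def[symmetric] L_def[symmetric] by linarith+
  have tail: "a ^ k \<le> \<epsilon>" if "n \<le> k" for k
  proof -
    have "L / l \<le> real k"
      using n_ge that by linarith
    then have "2 powr (L - real k * l) \<le> 2 powr 0"
      using l by (intro powr_mono) (auto simp: divide_le_eq)
    then show ?thesis
      using \<epsilon> by (simp add: scale)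
  qed
  have "real B \<le> (\<Sum>k<n. L + 1 - real k * l)"
    unfolding B_def of_nat_sum
  proof (rule sum_mono)
    fix k
    assume "k \<in> {..<n}"
    \<comment> \<open>For \<open>k < n\<close> the demand is nonnegative, so \<open>nat\<close> does
      not clip and rounding up costs at most one bit.\<close>
    then have "real k \<le> L / l"
      using n_le by auto
    then have "real k * l \<le> L"
      using l by (simp add: le_divide_eq)
    then show "real (b k) \<le> L + 1 - real k * l"
      unfolding b_def by linarith
  qed
  also have "\<dots> \<le> L\<^sup>2 / (2 * l) + (l / 2 + 1) * (1 / l + 1) * L"
    using bit_sum_le[OF L1 l] unfolding n_def l_def L_def .
  finally have bits: "real B \<le> L\<^sup>2 / (2 * l) + (l / 2 + 1) * (1 / l + 1) * L" .

  define I where "I = (\<Pi>\<^sub>E k\<in>{..<n}. {..<2 ^ b k :: nat})"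
  let ?W = "{w :: bool list. length w = B}"
  have "finite I" "card I = 2 ^ B"
    by (auto simp: I_def B_def card_PiE power_sum intro: finite_PiE)
  moreover have "finite ?W" "card ?W = 2 ^ B"
    using finite_lists_length_eq[of "UNIV :: bool set" B] card_lists_length_eq[of "UNIV :: bool set" B]
    by auto
  \<comment> \<open>Both sets have exactly \<open>2 ^ B\<close> elements, so any bijection packs the
    indices into words without waste.\<close>
  ultimately obtain g where g: "bij_betw g ?W I"
    by (metis finite_same_card_bij)
  define dec where "dec i k = (if k \<in> {1..n} then real (i (k - 1)) / 2 ^ b (k - 1) else 0)"
    for i :: "nat \<Rightarrow> nat" and k
  define R where "R w = phi a (dec (g w))" for w
  have dec_unit: "dec i \<in> unit_seqs" if "i \<in> I" for i
  proof -
    have "real (i k) \<le> 2 ^ b k" if "k < n" for k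
      using \<open>i \<in> I\<close> that by (force simp: I_def PiE_iff)
    then show ?thesis
      by (auto simp: unit_seqs_def dec_def)
  qed
  have approx: "\<exists>w\<in>?W. sup_norm (\<lambda>x. phi a t x - R w x) \<le> ereal \<epsilon>" if t: "t \<in> unit_seqs" for t
  proof -
    have "\<forall>k. \<exists>i<2 ^ b k. \<bar>t (Suc k) - real i / 2 ^ b k\<bar> \<le> 1 / 2 ^ b k"
      using quantise_unit_interval unit_seqs_bounds[OF t] by metis
    then obtain j where j: "\<And>k. j k < 2 ^ b k" "\<And>k. \<bar>t (Suc k) - real (j k) / 2 ^ b k\<bar> \<le> 1 / 2 ^ b k"
      by metis
    have i: "restrict j {..<n} \<in> I"
      using j by (auto simp: I_def)
    then obtain w where w: "w \<in> ?W" "g w = restrict j {..<n}"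
      using g by (auto simp: bij_betw_def)
    have "sup_norm (\<lambda>x. phi a t x - phi a (dec (restrict j {..<n})) x) \<le> ereal \<epsilon>"
      unfolding sup_norm_phi_diff[OF a t dec_unit[OF i]]
    proof (rule SUP_least)
      fix k :: nat
      assume "k \<in> {1..}"
      then obtain m where m: "k = Suc m" by (cases k) auto
      show "ereal (a ^ (k - 1) * \<bar>t k - dec (restrict j {..<n}) k\<bar>) \<le> ereal \<epsilon>"
      proof (cases "m < n")
        case True
        then have "a ^ m * \<bar>t k - dec (restrict j {..<n}) k\<bar> \<le> a ^ m * (1 / 2 ^ b m)"
          using a j(2)[of m] by (intro mult_left_mono) (auto simp: m dec_def)
        then show ?thesis
          using head[of m] by (simp add: m)
      next
        case False
        then have "a ^ m * \<bar>t k - dec (restrict j {..<n}) k\<bar> \<le> a ^ m * 1"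
          using a unit_seqs_bounds[OF t, of m] by (intro mult_left_mono) (auto simp: m dec_def)
        then show ?thesis
          using tail[of m] False by (simp add: m)
      qed
    qed
    then show ?thesis
      using w by (auto simp: R_def)
  qed
  \<comment> \<open>The encoder sees only the function, so it picks any word whose reconstruction is
    close enough.\<close>
  define E where "E f = (SOME w. w \<in> ?W \<and> sup_norm (\<lambda>x. f x - R w x) \<le> ereal \<epsilon>)" for f
  have E: "E f \<in> ?W \<and> sup_norm (\<lambda>x. f x - R (E f) x) \<le> ereal \<epsilon>" if "f \<in> phi a ` unit_seqs" for f
    unfolding E_def by (rule someI_ex) (use approx that in blast)
  have gI: "g w \<in> I" if "length w = B" for w
    using g that by (auto simp: bij_betw_def)
  show thesis
  proof (rule that)
    show "fixed_length_code (phi a ` unit_seqs) B E R"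
      unfolding fixed_length_code_def
    proof (intro conjI ballI allI impI)
      fix w :: "bool list"
      assume "length w = B"
      then show "bounded (range (R w))"
        unfolding R_def using a gI by (intro bounded_range_phi dec_unit) auto
    qed (use E in auto)
    show "distortion (phi a ` unit_seqs) E R \<le> ereal \<epsilon>"
      unfolding distortion_def using E by (intro SUP_least) auto
    show "real B \<le> (log 2 (1/\<epsilon>))\<^sup>2 / (2 * l) + (l / 2 + 1) * (1 / l + 1) * log 2 (1/\<epsilon>)"
      using bits by (simp add: L_def)
    fix w :: "bool list"
    assume "length w = B"
    then have "dec (g w) \<in> unit_seqs"
      using dec_unit gI by blast
    moreover have "dec (g w) k \<in> dyadics" for k
      using real_in_dyadics[of 0] by (auto simp: dec_def dyadics_def)
    ultimately show "\<exists>u\<in>unit_seqs. (\<forall>k>n. u k = 0) \<and> (\<forall>k\<ge>1. u k \<in> dyadics) \<and> R w = phi a u"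
      by (intro bexI[of _ "dec (g w)"] conjI) (simp_all add: R_def, simp add: dec_def)
  qed
qed

text \<open>The packing uses about \<open>log 2 (1/\<epsilon>) / l\<close> coordinates, the index at
  which \<open>a ^ k\<close> falls to \<open>\<epsilon>\<close>.\<close>

lemma entropy_ge_log_sq:
  assumes "0 < a" "a < 1" "0 < \<epsilon>" "1 \<le> log 2 (1/\<epsilon>)"
  defines "l \<equiv> log 2 (1/a)"
  shows "ereal ((log 2 (1/\<epsilon>))\<^sup>2 / (2 * l) - (l / 2 + 2 / l) * log 2 (1/\<epsilon>)) \<le> entropy \<epsilon> (phi a ` unit_seqs)"
proof -
  have "0 < l"
    using assms by (simp add: l_def)
  then have "ereal ((log 2 (1/\<epsilon>))\<^sup>2 / (2 * l) - (l / 2 + 2 / l) * log 2 (1/\<epsilon>)) \<le>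
    ereal (\<Sum>k<nat \<lfloor>log 2 (1/\<epsilon>) / l\<rfloor>. log 2 (1/\<epsilon>) - log 2 3 - real k * l)"
    using packing_sum_ge[OF assms(4), of l] by simp
  also have "\<dots> \<le> entropy \<epsilon> (phi a ` unit_seqs)"
    unfolding l_def using assms by (intro entropy_lower_packing) auto
  finally show ?thesis .
qed

section \<open>Asymptotics for small radii\<close>

lemma unit_seqs_nonempty: "unit_seqs \<noteq> {}"
  by (auto simp: unit_seqs_def intro: exI[of _ "\<lambda>_. 0"])

lemma eventually_log_inverse_ge: "\<forall>\<^sub>F \<epsilon> in at_right (0::real). 0 < \<epsilon> \<and> M \<le> log 2 (1/\<epsilon>)"
proof -
  have "log 2 (1/\<epsilon>) \<ge> M" if "0 < \<epsilon>" "\<epsilon> < 2 powr (- M)" for \<epsilon> :: real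
  proof -
    have "log 2 \<epsilon> < - M"
      using that by (simp add: log_less_iff)
    then show ?thesis
      using that by (simp add: log_divide)
  qed
  then show ?thesis
    unfolding eventually_at_right_field by (intro exI[of _ "2 powr (- M)"]) auto
qed

lemma dyadics_subset_Rats: "(dyadics :: real set) \<subseteq> \<rat>"
  by (auto simp: dyadics_def)

theorem theorem4p1:
  shows "\<exists>W::nat. \<forall>a::real. 1/2 < a \<and> a < 1 \<longrightarrow>
    \<comment> \<open>(i)\<close>
    (\<forall>t\<in>unit_seqs.
      (\<forall>n\<ge>1. sup_norm (\<lambda>x. cascade (\<lambda>k. subdiv (subdiv_mask a (t k))) n gen x - Phi a t x)
                \<le> ereal (a ^ n)) \<and>
      (\<forall>U :: nat \<Rightarrow> real^3^4. (\<forall>k\<ge>1. orthonormal_kernel_basis match_map (U k)) \<longrightarrow>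
        (\<forall>k\<ge>1. defect (\<lambda>_. match_map) U (\<lambda>k. subdiv_mask a (t k)) gen k = 0) \<and>
        has_chron_radius (kernel_block U (\<lambda>k. subdiv_mask a (t k))) a)) \<and>
    \<comment> \<open>(ii)\<close>
    (\<forall>t\<in>unit_seqs. \<forall>s\<in>unit_seqs.
      sup_norm (\<lambda>x. phi a t x - phi a s x) = (SUP k\<in>{1..}. ereal (a ^ (k - 1) * \<bar>t k - s k\<bar>))) \<and>
    (\<exists>K. \<forall>\<^sub>F \<epsilon> in at_right 0.
      \<bar>entropy \<epsilon> (phi a ` unit_seqs) - ereal ((log 2 (1/\<epsilon>))\<^sup>2 / (2 * log 2 (1/a)))\<bar>
        \<le> ereal (K * log 2 (1/\<epsilon>))) \<and>
    (\<forall>\<epsilon>>0. entropy \<epsilon> (Phi a ` unit_seqs) = entropy \<epsilon> (phi a ` unit_seqs)) \<and>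
    \<comment> \<open>(iii)\<close>
    (a \<in> \<rat> \<longrightarrow>
      (\<exists>K. \<forall>\<^sub>F \<epsilon> in at_right 0. \<exists>B E R.
        fixed_length_code (phi a ` unit_seqs) B E R \<and>
        distortion (phi a ` unit_seqs) E R \<le> ereal \<epsilon> \<and>
        real B \<le> (log 2 (1/\<epsilon>))\<^sup>2 / (2 * log 2 (1/a)) + K * log 2 (1/\<epsilon>) \<and>
        (\<forall>w. length w = B \<longrightarrow>
          (\<exists>u\<in>unit_seqs. finite {k. k \<ge> 1 \<and> u k \<noteq> 0} \<and> (\<forall>k\<ge>1. u k \<in> dyadics) \<and>
             R w = phi a u) \<and>
          (\<exists>N. computes N (R w) \<and> set (network_params N) \<subseteq> \<rat> \<and> network_width N \<le> W \<and>
             real (network_depth N) \<le> K * log 2 (1/\<epsilon>) \<and>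
             real (length (network_params N)) \<le> K * log 2 (1/\<epsilon>))))) \<and>
    (\<forall>c < 1 / (2 * log 2 (1/a)). \<forall>\<^sub>F \<epsilon> in at_right 0. \<forall>B E R.
      fixed_length_code (phi a ` unit_seqs) B E R \<and>
      distortion (phi a ` unit_seqs) E R \<le> ereal \<epsilon> \<longrightarrow>
        real B > c * (log 2 (1/\<epsilon>))\<^sup>2)"
\<comment> \<open>The width bound counts the five channels of \<open>phi_net\<close> and is chosen
  before \<open>a\<close>.\<close>
proof (rule exI[of _ 5], intro allI impI, (erule conjE)+, intro conjI impI)
  fix a :: real
  assume a: "1/2 < a" "a < 1"
  then have a_pos: "0 < a"
    by simp
  define l where "l = log 2 (1/a)"
  have l: "0 < l"
    using a by (simp add: l_def)
  have ne: "phi a ` unit_seqs \<noteq> {}"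
    using unit_seqs_nonempty by simp
  show "\<forall>t\<in>unit_seqs.
      (\<forall>n\<ge>1. sup_norm (\<lambda>x. cascade (\<lambda>k. subdiv (subdiv_mask a (t k))) n gen x - Phi a t x)
                \<le> ereal (a ^ n)) \<and>
      (\<forall>U :: nat \<Rightarrow> real^3^4. (\<forall>k\<ge>1. orthonormal_kernel_basis match_map (U k)) \<longrightarrow>
        (\<forall>k\<ge>1. defect (\<lambda>_. match_map) U (\<lambda>k. subdiv_mask a (t k)) gen k = 0) \<and>
        has_chron_radius (kernel_block U (\<lambda>k. subdiv_mask a (t k))) a)"
    using a by (auto intro!: cascade_close has_chron_radius_kernel_block simp: defect_eq_0)
  show "\<forall>t\<in>unit_seqs. \<forall>s\<in>unit_seqs.
      sup_norm (\<lambda>x. phi a t x - phi a s x) = (SUP k\<in>{1..}. ereal (a ^ (k - 1) * \<bar>t k - s k\<bar>))"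
    using a by (intro ballI sup_norm_phi_diff) auto
  show "\<forall>\<epsilon>>0. entropy \<epsilon> (Phi a ` unit_seqs) = entropy \<epsilon> (phi a ` unit_seqs)"
    by (auto intro: entropy_Phi_eq)
  show "\<exists>K. \<forall>\<^sub>F \<epsilon> in at_right 0.
      \<bar>entropy \<epsilon> (phi a ` unit_seqs) - ereal ((log 2 (1/\<epsilon>))\<^sup>2 / (2 * log 2 (1/a)))\<bar>
        \<le> ereal (K * log 2 (1/\<epsilon>))"
  \<comment> \<open>The constant stays schematic until the final \<open>show\<close>; it is fixed
    before \<open>\<epsilon>\<close>, so it is written out there in terms of \<open>l\<close>
    only.\<close>
  proof (rule exI, rule eventually_mono[OF eventually_log_inverse_ge[of 1]])
    fix \<epsilon> :: real
    assume \<epsilon>: "0 < \<epsilon> \<and> 1 \<le> log 2 (1/\<epsilon>)"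
    define L where "L = log 2 (1/\<epsilon>)"
    define K1 where "K1 = (l / 2 + 1) * (1 / l + 1)"
    define K2 where "K2 = l / 2 + 2 / l"
    have L: "1 \<le> L"
      using \<epsilon> by (simp add: L_def)
    obtain B E R where code: "fixed_length_code (phi a ` unit_seqs) B E R"
      "distortion (phi a ` unit_seqs) E R \<le> ereal \<epsilon>" "real B \<le> L\<^sup>2 / (2 * l) + K1 * L"
      unfolding L_def K1_def l_def by (rule quantisation_code[of a \<epsilon>, OF a_pos a(2)]) (use \<epsilon> in blast)+
    have "entropy \<epsilon> (phi a ` unit_seqs) \<le> ereal (real B)"
      by (rule entropy_le_code_length[OF code(1,2) ne])
    also have "\<dots> \<le> ereal (L\<^sup>2 / (2 * l) + K1 * L)"
      using code(3) by simp
    finally have up: "entropy \<epsilon> (phi a ` unit_seqs) \<le> ereal (L\<^sup>2 / (2 * l) + K1 * L)" .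
    have lo: "ereal (L\<^sup>2 / (2 * l) - K2 * L) \<le> entropy \<epsilon> (phi a ` unit_seqs)"
      using entropy_ge_log_sq[of a \<epsilon>] a \<epsilon> unfolding L_def K2_def l_def by auto
    \<comment> \<open>The two finite bounds make the entropy real, so the estimate can be done
      outside \<open>ereal\<close>.\<close>
    obtain r where r: "entropy \<epsilon> (phi a ` unit_seqs) = ereal r"
      using up lo by (cases "entropy \<epsilon> (phi a ` unit_seqs)") auto
    have "0 \<le> K1 * L" "0 \<le> K2 * L"
      using l L by (auto simp: K1_def K2_def)
    then have "\<bar>r - L\<^sup>2 / (2 * l)\<bar> \<le> (K1 + K2) * L"
      using up lo unfolding r by (simp add: distrib_right abs_le_iff)
    then show "\<bar>entropy \<epsilon> (phi a ` unit_seqs) - ereal ((log 2 (1/\<epsilon>))\<^sup>2 / (2 * log 2 (1/a)))\<bar>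
        \<le> ereal (((l / 2 + 1) * (1 / l + 1) + (l / 2 + 2 / l)) * log 2 (1/\<epsilon>))"
      unfolding r K1_def K2_def L_def l_def by simp
  qed
  show "\<exists>K. \<forall>\<^sub>F \<epsilon> in at_right 0. \<exists>B E R.
        fixed_length_code (phi a ` unit_seqs) B E R \<and>
        distortion (phi a ` unit_seqs) E R \<le> ereal \<epsilon> \<and>
        real B \<le> (log 2 (1/\<epsilon>))\<^sup>2 / (2 * log 2 (1/a)) + K * log 2 (1/\<epsilon>) \<and>
        (\<forall>w. length w = B \<longrightarrow>
          (\<exists>u\<in>unit_seqs. finite {k. k \<ge> 1 \<and> u k \<noteq> 0} \<and> (\<forall>k\<ge>1. u k \<in> dyadics) \<and>
             R w = phi a u) \<and>
          (\<exists>N. computes N (R w) \<and> set (network_params N) \<subseteq> \<rat> \<and> network_width N \<le> 5 \<and>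
             real (network_depth N) \<le> K * log 2 (1/\<epsilon>) \<and>
             real (length (network_params N)) \<le> K * log 2 (1/\<epsilon>)))"
    if "a \<in> \<rat>"
  proof -
    define K1 where "K1 = (l / 2 + 1) * (1 / l + 1)"
    \<comment> \<open>With \<open>n \<le> L / l + 1\<close> the parameter count
      \<open>30 * n + 16\<close> is at most \<open>30 * (L / l) + 46\<close>, and
      \<open>1 \<le> L\<close> turns 46 into \<open>46 * L\<close>.\<close>
    define K where "K = K1 + 30 / l + 46"
    have "\<exists>B E R.
        fixed_length_code (phi a ` unit_seqs) B E R \<and>
        distortion (phi a ` unit_seqs) E R \<le> ereal \<epsilon> \<and>
        real B \<le> (log 2 (1/\<epsilon>))\<^sup>2 / (2 * log 2 (1/a)) + K * log 2 (1/\<epsilon>) \<and>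
        (\<forall>w. length w = B \<longrightarrow>
          (\<exists>u\<in>unit_seqs. finite {k. k \<ge> 1 \<and> u k \<noteq> 0} \<and> (\<forall>k\<ge>1. u k \<in> dyadics) \<and>
             R w = phi a u) \<and>
          (\<exists>N. computes N (R w) \<and> set (network_params N) \<subseteq> \<rat> \<and> network_width N \<le> 5 \<and>
             real (network_depth N) \<le> K * log 2 (1/\<epsilon>) \<and>
             real (length (network_params N)) \<le> K * log 2 (1/\<epsilon>)))"
      if \<epsilon>: "0 < \<epsilon> \<and> 1 \<le> log 2 (1/\<epsilon>)" for \<epsilon> :: real
    proof -
      define L where "L = log 2 (1/\<epsilon>)"
      define n where "n = nat \<lceil>L / l\<rceil>"
      have L: "1 \<le> L"
        using \<epsilon> by (simp add: L_def)
      obtain B E R where code: "fixed_length_code (phi a ` unit_seqs) B E R"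
        "distortion (phi a ` unit_seqs) E R \<le> ereal \<epsilon>" "real B \<le> L\<^sup>2 / (2 * l) + K1 * L"
        "\<And>w. length w = B \<Longrightarrow>
          \<exists>u\<in>unit_seqs. (\<forall>k>n. u k = 0) \<and> (\<forall>k\<ge>1. u k \<in> dyadics) \<and> R w = phi a u"
        unfolding L_def K1_def l_def n_def
        by (rule quantisation_code[of a \<epsilon>, OF a_pos a(2)]) (use \<epsilon> in blast)+
      have "0 < L / l"
        using L l by simp
      then have "real n \<le> L / l + 1"
        unfolding n_def by linarith
      moreover have "0 \<le> K1 * L"
        using l L by (simp add: K1_def)
      moreover have "K * L = K1 * L + 30 * (L / l) + 46 * L"
        by (simp add: K_def distrib_right)
      ultimately have K: "K1 * L \<le> K * L" "real (30 * n + 16) \<le> K * L" "real (n + 1) \<le> K * L"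
        using L \<open>0 < L / l\<close> by (auto simp del: times_divide_eq_right)
      have "(\<exists>u\<in>unit_seqs. finite {k. k \<ge> 1 \<and> u k \<noteq> 0} \<and> (\<forall>k\<ge>1. u k \<in> dyadics) \<and> R w = phi a u) \<and>
          (\<exists>N. computes N (R w) \<and> set (network_params N) \<subseteq> \<rat> \<and> network_width N \<le> 5 \<and>
             real (network_depth N) \<le> K * L \<and> real (length (network_params N)) \<le> K * L)"
        if len: "length w = B" for w
      proof -
        obtain u where u: "u \<in> unit_seqs" "\<And>k. k > n \<Longrightarrow> u k = 0" "\<And>k. k \<ge> 1 \<Longrightarrow> u k \<in> dyadics"
          "R w = phi a u"
          using code(4)[OF len] by blast
        have "{k. k \<ge> 1 \<and> u k \<noteq> 0} \<subseteq> {..n}"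
          using u(2) by (auto simp: not_less[symmetric])
        then have fin: "finite {k. k \<ge> 1 \<and> u k \<noteq> 0}"
          by (rule finite_subset) simp
        have "computes (phi_net a u n) (R w)"
          unfolding u(4) using a u(2) unit_seqs_bounds[OF u(1)] by (intro computes_phi_net) auto
        moreover have "set (network_params (phi_net a u n)) \<subseteq> \<rat>"
          using \<open>a \<in> \<rat>\<close> u(3) dyadics_subset_Rats by (intro phi_net_rational) auto
        moreover have "real (network_depth (phi_net a u n)) \<le> K * L"
          "real (length (network_params (phi_net a u n))) \<le> K * L"
          unfolding phi_net_size using K by auto
        ultimately show ?thesis
          using u fin phi_net_size(2)[of a u n] by blast
      qed
      moreover have "real B \<le> L\<^sup>2 / (2 * l) + K * L"
        using code(3) K(1) by linarith
      ultimately show ?thesis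
        using code(1,2) unfolding L_def l_def by blast
    qed
    then show ?thesis
      by (intro exI[of _ K] eventually_mono[OF eventually_log_inverse_ge[of 1]]) blast
  qed
  show "\<forall>c < 1 / (2 * log 2 (1/a)). \<forall>\<^sub>F \<epsilon> in at_right 0. \<forall>B E R.
      fixed_length_code (phi a ` unit_seqs) B E R \<and>
      distortion (phi a ` unit_seqs) E R \<le> ereal \<epsilon> \<longrightarrow>
        real B > c * (log 2 (1/\<epsilon>))\<^sup>2"
  proof (intro allI impI)
    fix c
    assume c: "c < 1 / (2 * log 2 (1/a))"
    define d where "d = 1 / (2 * l) - c"
    define K where "K = l / 2 + 2 / l"
    have d: "0 < d"
      using c by (simp add: d_def l_def)
    show "\<forall>\<^sub>F \<epsilon> in at_right 0. \<forall>B E R.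
      fixed_length_code (phi a ` unit_seqs) B E R \<and>
      distortion (phi a ` unit_seqs) E R \<le> ereal \<epsilon> \<longrightarrow>
        real B > c * (log 2 (1/\<epsilon>))\<^sup>2"
    \<comment> \<open>Beyond \<open>K / d\<close> the linear loss \<open>K * L\<close> is smaller
      than the quadratic gap \<open>d * L * L\<close>; the 1 is what the entropy bound asks
      for.\<close>
    proof (rule eventually_mono[OF eventually_log_inverse_ge[of "max 1 (K / d + 1)"]], intro allI impI)
      fix \<epsilon> :: real and B E R
      assume \<epsilon>: "0 < \<epsilon> \<and> max 1 (K / d + 1) \<le> log 2 (1/\<epsilon>)"
        and code: "fixed_length_code (phi a ` unit_seqs) B E R \<and>
          distortion (phi a ` unit_seqs) E R \<le> ereal \<epsilon>"
      define L where "L = log 2 (1/\<epsilon>)"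
      have L: "1 \<le> L" "K / d < L"
        using \<epsilon> by (auto simp: L_def)
      have "ereal (L\<^sup>2 / (2 * l) - K * L) \<le> entropy \<epsilon> (phi a ` unit_seqs)"
        using entropy_ge_log_sq[of a \<epsilon>] a \<epsilon> unfolding L_def K_def l_def by auto
      also have "\<dots> \<le> ereal (real B)"
        using entropy_le_code_length[of _ B E R \<epsilon>] code ne by blast
      finally have "L\<^sup>2 / (2 * l) - K * L \<le> real B"
        by simp
      moreover have "K * L < d * L * L"
        using L d by (intro mult_strict_right_mono) (auto simp: divide_less_eq mult.commute)
      moreover have "d * L * L = L\<^sup>2 / (2 * l) - c * L\<^sup>2"
        by (simp add: d_def power2_eq_square left_diff_distrib)
      ultimately show "real B > c * (log 2 (1/\<epsilon>))\<^sup>2"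
        unfolding L_def by linarith
    qed
  qed
qed

end
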